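(* Let $G$ be a (simple) cubic graph with exactly one end, and suppose this end has degree $2$. If $G$ has a Hamilton cycle, then $G$ has at least two distinct Hamilton cycles.
   Context: Graphs are simple. A cubic graph is a graph in which every vertex has degree $3$ (here infinite, hence locally finite). For a locally finite connected graph $G$, $|G|$ denotes its Freudenthal compactification. A circle in $|G|$ is a homeomorphic image of the unit circle in $|G|$; it is a Hamilton circle if it contains all vertices and all ends of $G$. A Hamilton cycle of $G$ is the subgraph formed by the vertices and edges contained in a Hamilton circle of $|G|$. The degree of an end $\omega$ is the maximum number of pairwise edge-disjoint rays in $G$ belonging to $\omega$. *)

theory Defs
  imports "HOL-Analysis.Analysis"
begin

record 'a ugraph =
  verts :: "'a set"
  edges :: "'a set set"

definition simple_graph :: "'a ugraph \<Rightarrow> bool" where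
  "simple_graph G \<longleftrightarrow> (\<forall>e\<in>edges G. e \<subseteq> verts G \<and> card e = 2)"

definition vert_degree :: "'a ugraph \<Rightarrow> 'a \<Rightarrow> nat" where
  "vert_degree G v = card {e \<in> edges G. v \<in> e}"

definition cubic_graph :: "'a ugraph \<Rightarrow> bool" where
  "cubic_graph G \<longleftrightarrow> simple_graph G \<and> (\<forall>v\<in>verts G. vert_degree G v = 3)"

definition reachable :: "'a ugraph \<Rightarrow> 'a \<Rightarrow> 'a \<Rightarrow> bool" where
  "reachable G u v \<longleftrightarrow>
     u \<in> verts G \<and> v \<in> verts G \<and> (\<lambda>x y. {x, y} \<in> edges G)\<^sup>*\<^sup>* u v"

definition connected_graph :: "'a ugraph \<Rightarrow> bool" where
  "connected_graph G \<longleftrightarrow> verts G \<noteq> {} \<and> (\<forall>u\<in>verts G. \<forall>v\<in>verts G. reachable G u v)"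

text \<open>Components are represented by their vertex sets.\<close>

definition components_of_graph :: "'a ugraph \<Rightarrow> 'a set set" where
  "components_of_graph G = (\<lambda>v. {u. reachable G v u}) ` verts G"

definition delete_verts :: "'a ugraph \<Rightarrow> 'a set \<Rightarrow> 'a ugraph" where
  "delete_verts G S = \<lparr>verts = verts G - S, edges = {e \<in> edges G. e \<inter> S = {}}\<rparr>"

text \<open>
  A ray is enumerated from its unique vertex of degree 1, so rays (as subgraphs) and the
  sequences below correspond bijectively.
\<close>

definition ray :: "'a ugraph \<Rightarrow> (nat \<Rightarrow> 'a) \<Rightarrow> bool" where
  "ray G r \<longleftrightarrow> inj r \<and> (\<forall>n. {r n, r (Suc n)} \<in> edges G)"

definition ray_edges :: "(nat \<Rightarrow> 'a) \<Rightarrow> 'a set set" where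
  "ray_edges r = range (\<lambda>n. {r n, r (Suc n)})"

definition has_tail_in :: "(nat \<Rightarrow> 'a) \<Rightarrow> 'a set \<Rightarrow> bool" where
  "has_tail_in r K \<longleftrightarrow> (\<exists>n. \<forall>m\<ge>n. r m \<in> K)"

definition ray_equiv :: "'a ugraph \<Rightarrow> ((nat \<Rightarrow> 'a) \<times> (nat \<Rightarrow> 'a)) set" where
  "ray_equiv G = {(r, s). ray G r \<and> ray G s \<and>
     (\<forall>S. finite S \<and> S \<subseteq> verts G \<longrightarrow>
       (\<exists>K\<in>components_of_graph (delete_verts G S). has_tail_in r K \<and> has_tail_in s K))}"

definition ends :: "'a ugraph \<Rightarrow> (nat \<Rightarrow> 'a) set set" where
  "ends G = {r. ray G r} // ray_equiv G"

text \<open>Taking finite families makes the degree \<open>\<infinity>\<close> if their sizes are unbounded.\<close>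

definition end_degree :: "(nat \<Rightarrow> 'a) set \<Rightarrow> enat" where
  "end_degree \<omega> = Sup {enat (card R) |R. finite R \<and> R \<subseteq> \<omega> \<and>
     pairwise (\<lambda>r s. disjnt (ray_edges r) (ray_edges s)) R}"

definition lives_in :: "(nat \<Rightarrow> 'a) set \<Rightarrow> 'a set \<Rightarrow> bool" where
  "lives_in \<omega> K \<longleftrightarrow> (\<forall>r\<in>\<omega>. has_tail_in r K)"

text \<open>
  Points of the 1-complex of a graph are given by barycentric coordinates, so that no
  orientation of the edges has to be chosen: \<open>edge_pt u v t = edge_pt v u (1 - t)\<close>, and
  \<open>edge_pt u v 0\<close> is the vertex \<open>u\<close>.
\<close>

datatype 'a point = Pt "'a \<Rightarrow> real" | End "(nat \<Rightarrow> 'a) set"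

definition vert_pt :: "'a \<Rightarrow> 'a point" where
  "vert_pt v = Pt (indicator {v})"

definition edge_pt :: "'a \<Rightarrow> 'a \<Rightarrow> real \<Rightarrow> 'a point" where
  "edge_pt u v t = Pt (\<lambda>w. (1 - t) * indicator {u} w + t * indicator {v} w)"

definition closed_edge :: "'a set \<Rightarrow> 'a point set" where
  "closed_edge e = {edge_pt u v t |u v t. e = {u, v} \<and> 0 \<le> t \<and> t \<le> 1}"

text \<open>
  The three kinds of basic open sets of the Freudenthal compactification, around inner
  points of edges, vertices and ends. In \<open>end_nbhd G S K \<epsilon>\<close>, \<open>K\<close> is a component of \<open>G - S\<close>;
  the set consists of \<open>K\<close>, the ends living in \<open>K\<close>, and the inner points of the edges
  between \<open>S\<close> and \<open>K\<close> at distance less than \<open>\<epsilon>\<close> from their endpoint in \<open>K\<close>.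
\<close>

definition open_segment_of_edge :: "'a \<Rightarrow> 'a \<Rightarrow> real \<Rightarrow> real \<Rightarrow> 'a point set" where
  "open_segment_of_edge u v a b = edge_pt u v ` {a<..<b}"

definition vert_nbhd :: "'a ugraph \<Rightarrow> 'a \<Rightarrow> ('a \<Rightarrow> real) \<Rightarrow> 'a point set" where
  "vert_nbhd G v d =
     {vert_pt v} \<union> {edge_pt v w t |w t. {v, w} \<in> edges G \<and> 0 < t \<and> t < d w}"

definition end_nbhd :: "'a ugraph \<Rightarrow> 'a set \<Rightarrow> 'a set \<Rightarrow> real \<Rightarrow> 'a point set" where
  "end_nbhd G S K \<epsilon> =
     vert_pt ` K \<union>
     {edge_pt u v t |u v t. u \<in> K \<and> v \<in> K \<and> {u, v} \<in> edges G \<and> 0 < t \<and> t < 1} \<union>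
     {edge_pt u v t |u v t. u \<in> K \<and> v \<in> S \<and> {u, v} \<in> edges G \<and> 0 < t \<and> t < \<epsilon>} \<union>
     End ` {\<omega> \<in> ends G. lives_in \<omega> K}"

definition freudenthal :: "'a ugraph \<Rightarrow> 'a point topology" where
  "freudenthal G = topology_generated_by
     ({open_segment_of_edge u v a b |u v a b. {u, v} \<in> edges G \<and> 0 \<le> a \<and> a < b \<and> b \<le> 1} \<union>
      {vert_nbhd G v d |v d. v \<in> verts G \<and> (\<forall>w. 0 < d w \<and> d w \<le> 1)} \<union>
      {end_nbhd G S K \<epsilon> |S K \<epsilon> \<omega>. finite S \<and> S \<subseteq> verts G \<and>
         K \<in> components_of_graph (delete_verts G S) \<and>
         \<omega> \<in> ends G \<and> lives_in \<omega> K \<and> 0 < \<epsilon> \<and> \<epsilon> \<le> 1})"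

definition circle_in :: "'b topology \<Rightarrow> 'b set \<Rightarrow> bool" where
  "circle_in X C \<longleftrightarrow> C \<subseteq> topspace X \<and>
     top_of_set (sphere (0::complex) 1) homeomorphic_space subtopology X C"

definition hamilton_circle :: "'a ugraph \<Rightarrow> 'a point set \<Rightarrow> bool" where
  "hamilton_circle G C \<longleftrightarrow>
     circle_in (freudenthal G) C \<and> vert_pt ` verts G \<subseteq> C \<and> End ` ends G \<subseteq> C"

definition hamilton_cycle :: "'a ugraph \<Rightarrow> 'a ugraph \<Rightarrow> bool" where
  "hamilton_cycle G H \<longleftrightarrow> (\<exists>C. hamilton_circle G C \<and>
     H = \<lparr>verts = {v \<in> verts G. vert_pt v \<in> C}, edges = {e \<in> edges G. closed_edge e \<subseteq> C}\<rparr>)"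

end

theory Submission
  imports Defs
begin

text \<open>
  In a one-ended graph, Hamilton circles are the spanning double rays together with the end.
  Index the vertices by \<open>int\<close> along such a double ray; the remaining edges form a perfect
  matching of chords. Consider the flow of value 2 that leaves \<open>0\<close> along the two halves of the
  double ray. If infinitely many vertices can be reached from \<open>0\<close> in its residual network, then
  there is an augmenting ray, hence a flow of value 3, hence three edge-disjoint rays; this is
  excluded by the degree of the end. Otherwise the reachable vertices form a finite interval
  \<open>{c..d}\<close> that no chord leaves. All its vertices other than \<open>c\<close> and \<open>d\<close> have degree 3 inside
  the interval, so Thomason's lollipop argument shows that the number of Hamilton paths of the
  interval from \<open>c\<close> to \<open>d\<close> is even. Rerouting the double ray along a second such path gives the
  second Hamilton cycle.
\<close>

section \<open>Parity of Hamilton paths\<close>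

text \<open>The absence of three disjoint rays has to yield a cut of two edges, although the graph
  is infinite. The line itself already carries a flow of value 2, so a single augmentation decides:
  if it fails, the two line edges leaving the interval are the cut. Cubicity is used twice. Each
  vertex has one chord besides its two line edges, so at most one unit of flow passes through a
  vertex other than \<open>0\<close>; strands are therefore disjoint in vertices, and a flow can be
  encoded by a successor function on the integers. In the parity count, the cut takes one edge away
  from \<open>c\<close> and one from \<open>d\<close>, so that odd degree survives at every other
  vertex of the interval. The count concerns the finite interval alone; both infinite tails are
  kept, and a shared tail makes it easy to tell the two cycles apart. Topology enters only in the
  translation between circles and double rays: removing the end from a circle leaves a real line,
  and a line that tends to the end on both sides closes up to a circle.\<close>

lemma even_card_fixpoint_free_involution:
  assumes "finite A" "\<And>x. x \<in> A \<Longrightarrow> f x \<in> A" "\<And>x. x \<in> A \<Longrightarrow> f (f x) = x" "\<And>x. x \<in> A \<Longrightarrow> f x \<noteq> x"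
  shows "even (card A)"
  using assms
proof (induction A rule: finite_psubset_induct)
  case (psubset A)
  show ?case
  proof (cases "A = {}")
    case False
    then obtain x where x: "x \<in> A" by blast
    let ?B = "A - {x, f x}"
    have "even (card ?B)"
    proof (rule psubset.IH)
      show "?B \<subset> A" using x by blast
      show "f y \<in> ?B" if "y \<in> ?B" for y
        using that x psubset.prems by (metis DiffD1 DiffD2 DiffI insertE insertI1 insertI2 singletonD)
    qed (use psubset.prems in auto)
    moreover have "card A = card ?B + 2"
    proof -
      have "card {x, f x} = 2" using psubset.prems(3)[OF x] by simp
      moreover have "{x, f x} \<subseteq> A" using x psubset.prems by blast
      ultimately show ?thesis using psubset.hyps
        by (metis card_Diff_subset card_mono finite.emptyI finite_insert le_add_diff_inverse2)
    qed
    ultimately show ?thesis by simp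
  qed simp
qed

text \<open>Handshaking: \<open>R\<close> is the arc set of a graph on \<open>P\<close>. Reversal
  pairs the arcs off, so \<open>card R\<close>, which is the degree sum, is even.\<close>

lemma even_card_odd_degree:
  assumes "finite P" "R \<subseteq> P \<times> P" "sym R" "irrefl R"
  shows "even (card {x \<in> P. odd (card (R `` {x}))})"
proof -
  have fin: "finite R" using assms finite_subset by blast
  have "even (card R)"
  proof (rule even_card_fixpoint_free_involution[where f = prod.swap])
    show "prod.swap p \<in> R" if "p \<in> R" for p using that assms(3) by (cases p) (auto dest: symD)
    show "prod.swap p \<noteq> p" if "p \<in> R" for p using that assms(4) by (cases p) (auto simp: irrefl_def)
  qed (use fin in auto)
  moreover have "R = (SIGMA x:P. R `` {x})" using assms(2) by blast
  then have "card R = (\<Sum>x\<in>P. card (R `` {x}))"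
    using card_SigmaI[of P "\<lambda>x. R `` {x}"] assms(1) fin finite_Image[OF fin] by metis
  ultimately show ?thesis using even_sum_iff[OF assms(1)] by metis
qed

section \<open>Paths as lists and their rotations\<close>

lemma successively_nth:
  "successively P xs \<Longrightarrow> Suc i < length xs \<Longrightarrow> P (xs ! i) (xs ! Suc i)"
proof (induction xs arbitrary: i)
  case (Cons x xs)
  then show ?case by (cases i; cases xs) (auto simp: successively_Cons)
qed simp

definition ham_paths :: "('a \<Rightarrow> 'a \<Rightarrow> bool) \<Rightarrow> 'a set \<Rightarrow> 'a \<Rightarrow> 'a \<Rightarrow> 'a list set" where
  "ham_paths adj X a b =
     {xs. xs \<noteq> [] \<and> distinct xs \<and> set xs = X \<and> hd xs = a \<and> last xs = b \<and> successively adj xs}"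

text \<open>Posa's rotation: it inserts the edge between entry \<open>i\<close> and the last vertex
  and drops the edge between entries \<open>i\<close> and \<open>Suc i\<close>, so that entry
  \<open>Suc i\<close> becomes the new last vertex.\<close>

definition rotate_tail :: "nat \<Rightarrow> 'a list \<Rightarrow> 'a list" where
  "rotate_tail i ys = take (Suc i) ys @ rev (drop (Suc i) ys)"

lemma rotate_tail_involution: "rotate_tail i (rotate_tail i ys) = ys"
  by (cases "Suc i \<le> length ys") (auto simp: rotate_tail_def)

lemma length_rotate_tail [simp]: "length (rotate_tail i ys) = length ys"
  by (auto simp: rotate_tail_def)

lemma set_rotate_tail [simp]: "set (rotate_tail i ys) = set ys"
  by (simp add: rotate_tail_def) (metis append_take_drop_id set_append)

lemma distinct_rotate_tail [simp]: "distinct (rotate_tail i ys) = distinct ys"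
  by (simp add: rotate_tail_def) (metis append_take_drop_id distinct_append)

lemma hd_rotate_tail [simp]: "hd (rotate_tail i ys) = hd ys"
  by (cases ys) (auto simp: rotate_tail_def)

lemma last_rotate_tail: "Suc i < length ys \<Longrightarrow> last (rotate_tail i ys) = ys ! Suc i"
  by (simp add: rotate_tail_def last_rev hd_drop_conv_nth)

text \<open>By symmetry of \<open>adj\<close> the reversed tail is still a path, so only the seam
  between the two pieces remains: entry \<open>i\<close> followed by the old last entry.\<close>

lemma successively_rotate_tail:
  assumes "symp adj" "successively adj ys" "Suc i < length ys"
  shows "successively adj (rotate_tail i ys) \<longleftrightarrow> adj (ys ! i) (last ys)"
proof -
  have split: "successively adj (take (Suc i) ys @ drop (Suc i) ys)" using assms(2) by simp
  have ne: "take (Suc i) ys \<noteq> []" "drop (Suc i) ys \<noteq> []" using assms(3) by auto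
  have "(\<lambda>x y. adj y x) = adj" using assms(1) by (auto simp: symp_def fun_eq_iff)
  then have "successively adj (rev (drop (Suc i) ys))"
    using split by (metis successively_append_iff successively_rev)
  moreover have "last (take (Suc i) ys) = ys ! i"
    using assms(3) by (simp add: take_Suc_conv_app_nth)
  moreover have "successively adj (take (Suc i) ys)"
    using split by (metis successively_append_iff)
  ultimately show ?thesis
    using ne assms(3) unfolding rotate_tail_def
    by (simp add: successively_append_iff hd_rev)
qed

theorem even_card_ham_paths:
  assumes fin: "finite X" and ab: "a \<in> X" "b \<in> X" "a \<noteq> b" "X \<noteq> {a, b}"
    and sym: "symp adj" and irr: "irreflp adj"
    and odd_deg: "\<And>x. x \<in> X - {a, b} \<Longrightarrow> odd (card {y \<in> X. adj x y})"
  shows "even (card (ham_paths adj X a b))"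
proof -
  \<comment> \<open>Two paths from \<open>a\<close> that miss only \<open>b\<close> are adjacent in \<open>R\<close> if each arises from the other by
    reversing a final segment. A path has odd degree in \<open>R\<close> iff it extends to \<open>b\<close>.\<close>
  define P where "P = {ys. ys \<noteq> [] \<and> distinct ys \<and> set ys = X - {b} \<and> hd ys = a \<and> successively adj ys}"
  define R where "R = {(ys, zs). ys \<in> P \<and> zs \<in> P \<and> (\<exists>i. Suc (Suc i) < length ys \<and> zs = rotate_tail i ys)}"
  have adj_sym: "adj x y = adj y x" for x y using sym by (auto simp: symp_def)
  have finP: "finite P"
  proof -
    have "P \<subseteq> {xs. set xs \<subseteq> X \<and> distinct xs}" unfolding P_def by auto
    then show ?thesis using finite_subset_distinct[OF fin] finite_subset by blast
  qed
  have symR: "sym R"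
  proof (rule symI)
    fix ys zs assume "(ys, zs) \<in> R"
    then obtain i where "ys \<in> P" "zs \<in> P" "Suc (Suc i) < length ys" "zs = rotate_tail i ys"
      unfolding R_def by blast
    then show "(zs, ys) \<in> R"
      unfolding R_def using rotate_tail_involution[of i ys] by fastforce
  qed
  have irrR: "irrefl R"
  proof -
    have False if "ys \<in> P" "Suc (Suc i) < length ys" "ys = rotate_tail i ys" for ys i
    proof -
      have "ys ! Suc i = last ys" using last_rotate_tail[of i ys] that by simp
      then have "ys ! Suc i = ys ! (length ys - 1)" using that(2) by (metis last_conv_nth list.size(3) not_less0)
      then show False using that(1,2) unfolding P_def by (auto simp: nth_eq_iff_index_eq)
    qed
    then show ?thesis unfolding irrefl_def R_def by blast
  qed
  have deg: "odd (card (R `` {ys})) \<longleftrightarrow> adj (last ys) b" if ys: "ys \<in> P" for ys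
  proof -
    define n where "n = length ys"
    define z where "z = last ys"
    define I where "I = {i. Suc (Suc i) < n \<and> adj (ys ! i) z}"
    have ysP: "ys \<noteq> []" "distinct ys" "set ys = X - {b}" "hd ys = a" "successively adj ys"
      using ys unfolding P_def by auto
    \<comment> \<open>Here \<open>X \<noteq> {a, b}\<close> enters: the last vertex of a path
      \<open>[a]\<close> would be \<open>a\<close>, about whose degree nothing is assumed.\<close>
    have n2: "n \<ge> 2"
    proof (rule ccontr)
      assume "\<not> n \<ge> 2"
      moreover have "n \<noteq> 0" using ysP(1) unfolding n_def by simp
      ultimately have "n = 1" by linarith
      then have "ys = [a]" using ysP(4) unfolding n_def by (metis One_nat_def length_0_conv length_Suc_conv list.sel(1))
      then show False using ysP(3) ab by auto
    qed
    have z: "z = ys ! (n - 1)" unfolding z_def n_def using ysP(1) by (rule last_conv_nth)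
    have "z \<in> X - {b}" using ysP unfolding z_def by (metis last_in_set)
    moreover have "z \<noteq> a"
    proof -
      have "a = ys ! 0" using ysP(1,4) by (simp add: hd_conv_nth)
      moreover have "n - 1 < length ys" "0 < length ys" "n - 1 \<noteq> 0" using n2 unfolding n_def by auto
      ultimately show ?thesis using z ysP(2) nth_eq_iff_index_eq by metis
    qed
    ultimately have zX: "z \<in> X - {a, b}" by blast
    have img: "R `` {ys} = (\<lambda>i. rotate_tail i ys) ` I"
    proof -
      have "rotate_tail i ys \<in> P \<longleftrightarrow> adj (ys ! i) z" if "Suc (Suc i) < n" for i
        using successively_rotate_tail[OF sym ysP(5), of i] that ysP
        unfolding P_def n_def z_def by (auto simp: length_greater_0_conv[symmetric] simp del: length_greater_0_conv)
      then show ?thesis unfolding R_def I_def using ys unfolding n_def by auto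
    qed
    have inj: "inj_on (\<lambda>i. rotate_tail i ys) I"
    proof (rule inj_onI)
      fix i j assume ij: "i \<in> I" "j \<in> I" "rotate_tail i ys = rotate_tail j ys"
      then have "ys ! Suc i = ys ! Suc j"
        using last_rotate_tail[of i ys] last_rotate_tail[of j ys] unfolding I_def n_def by auto
      then show "i = j" using ij ysP(2) unfolding I_def n_def by (simp add: nth_eq_iff_index_eq)
    qed
    \<comment> \<open>The neighbours of \<open>z\<close> are the pivots of its rotations, its
      predecessor on the path (rotating there would change nothing) and possibly \<open>b\<close>.
      As their number is odd, the number of rotations is odd exactly if
      \<open>adj z b\<close>.\<close>
    have "{y \<in> X. adj z y} = (!) ys ` I \<union> {ys ! (n - 2)} \<union> (if adj z b then {b} else {})"
    proof (intro set_eqI iffI)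
      fix y assume y: "y \<in> {y \<in> X. adj z y}"
      show "y \<in> (!) ys ` I \<union> {ys ! (n - 2)} \<union> (if adj z b then {b} else {})"
      proof (cases "y = b")
        case False
        then have "y \<in> set ys" using y ysP(3) by auto
        then obtain i where i: "i < n" "y = ys ! i" unfolding n_def by (metis in_set_conv_nth)
        have "i \<noteq> n - 1" using i y z irr by (auto simp: irreflp_def)
        then have "i = n - 2 \<or> Suc (Suc i) < n" using i by linarith
        then show ?thesis using i y adj_sym unfolding I_def by auto
      qed (use y in auto)
    next
      fix y assume y: "y \<in> (!) ys ` I \<union> {ys ! (n - 2)} \<union> (if adj z b then {b} else {})"
      have "adj (ys ! (n - 2)) (ys ! Suc (n - 2))"
        using successively_nth[OF ysP(5), of "n - 2"] n2 unfolding n_def by simp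
      moreover have "Suc (n - 2) = n - 1" using n2 by simp
      ultimately have "adj (ys ! (n - 2)) z" unfolding z by simp
      moreover have "ys ! i \<in> X" if "i < n" for i using that ysP(3) nth_mem unfolding n_def by blast
      ultimately show "y \<in> {y \<in> X. adj z y}"
        using y n2 adj_sym ab unfolding I_def by (auto split: if_splits)
    qed
    moreover have finI: "finite I" unfolding I_def by (rule finite_subset[of _ "{..<n}"]) auto
    moreover have injys: "inj_on ((!) ys) {..<n}" using ysP(2) unfolding n_def
      by (auto intro!: inj_onI simp: nth_eq_iff_index_eq)
    then have "card ((!) ys ` I) = card I"
      by (intro card_image) (auto intro: inj_on_subset simp: I_def)
    moreover have "ys ! (n - 2) \<notin> (!) ys ` I"
      using injys n2 unfolding I_def by (auto dest!: inj_onD)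
    moreover have "b \<notin> (!) ys ` I \<union> {ys ! (n - 2)}"
    proof -
      have "(!) ys ` I \<union> {ys ! (n - 2)} \<subseteq> set ys"
        using n2 unfolding I_def n_def by (auto intro!: nth_mem)
      then show ?thesis using ysP(3) by blast
    qed
    ultimately have "card {y \<in> X. adj z y} = card I + 1 + (if adj z b then 1 else 0)"
      by (simp add: card_insert_if) metis
    then have "odd (card I) \<longleftrightarrow> adj z b" using odd_deg[OF zX] by (auto split: if_splits)
    then show ?thesis using img inj by (simp add: card_image z_def)
  qed
  have "ham_paths adj X a b = (\<lambda>ys. ys @ [b]) ` {ys \<in> P. adj (last ys) b}"
  proof (intro set_eqI iffI)
    fix xs assume "xs \<in> ham_paths adj X a b"
    then have xs: "xs \<noteq> []" "distinct xs" "set xs = X" "hd xs = a" "last xs = b" "successively adj xs"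
      unfolding ham_paths_def by auto
    define ys where "ys = butlast xs"
    have eq: "xs = ys @ [b]" using xs(1,5) unfolding ys_def by (metis append_butlast_last_id)
    have "ys \<noteq> []" using eq xs(4) ab by auto
    then have "successively adj ys \<and> adj (last ys) b"
      using xs(6) unfolding eq by (simp add: successively_append_iff)
    moreover have "distinct ys" "set ys = X - {b}" "hd ys = a"
      using xs(2-4) \<open>ys \<noteq> []\<close> unfolding eq by auto
    ultimately have "ys \<in> P \<and> adj (last ys) b"
      using \<open>ys \<noteq> []\<close> unfolding P_def by simp
    then show "xs \<in> (\<lambda>ys. ys @ [b]) ` {ys \<in> P. adj (last ys) b}" using eq by blast
  next
    fix xs assume "xs \<in> (\<lambda>ys. ys @ [b]) ` {ys \<in> P. adj (last ys) b}"
    then obtain ys where ys: "ys \<in> P" "adj (last ys) b" "xs = ys @ [b]" by blast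
    then have "successively adj xs" unfolding P_def by (simp add: successively_append_iff)
    then show "xs \<in> ham_paths adj X a b"
      using ys(1) ab(2) unfolding ham_paths_def P_def ys(3) by (simp add: insert_absorb)
  qed
  then have "card (ham_paths adj X a b) = card {ys \<in> P. adj (last ys) b}"
    by (simp add: card_image inj_on_def)
  also have "{ys \<in> P. adj (last ys) b} = {ys \<in> P. odd (card (R `` {ys}))}" using deg by blast
  finally show ?thesis
    using even_card_odd_degree[OF finP _ symR irrR] unfolding R_def by auto
qed

section \<open>Augmenting a flow along the integer line\<close>

text \<open>A walk from \<open>x\<close> can be cut at its last visit to \<open>x\<close>, so apart
  from \<open>x\<close> itself everything reachable is reachable from one of finitely many
  successors without meeting \<open>x\<close> again; one of them must reach infinitely much.\<close>

lemma infinite_reachable_avoiding_step: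
  fixes R :: "'a \<Rightarrow> 'a \<Rightarrow> bool"
  defines "Rch \<equiv> \<lambda>A x. {y. (\<lambda>u v. R u v \<and> v \<notin> A)\<^sup>*\<^sup>* x y}"
  assumes "finite {y. R x y}" "infinite (Rch A x)"
  shows "\<exists>y. R x y \<and> y \<notin> insert x A \<and> infinite (Rch (insert x A) y)"
proof (rule ccontr)
  assume neg: "\<not> ?thesis"
  let ?Y = "{y. R x y \<and> y \<notin> insert x A}"
  have "finite ?Y" using assms(2) by (rule rev_finite_subset) auto
  then have "finite (insert x (\<Union>y\<in>?Y. Rch (insert x A) y))" using neg by auto
  moreover have "Rch A x \<subseteq> insert x (\<Union>y\<in>?Y. Rch (insert x A) y)"
  proof
    fix z assume "z \<in> Rch A x"
    then have "(\<lambda>u v. R u v \<and> v \<notin> A)\<^sup>*\<^sup>* x z" unfolding Rch_def by simp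
    then show "z \<in> insert x (\<Union>y\<in>?Y. Rch (insert x A) y)"
    proof (induction rule: rtranclp_induct)
      case (step y z)
      show ?case
      proof (cases "z = x")
        case False
        with step show ?thesis
          unfolding Rch_def by (auto intro: rtranclp.rtrancl_into_rtrancl)
      qed simp
    qed simp
  qed
  ultimately show False using assms(3) finite_subset by blast
qed

text \<open>Koenig's lemma; the recursion carries the set of vertices used so far along.\<close>

lemma injective_path_if_infinite_reachable:
  fixes R :: "'a \<Rightarrow> 'a \<Rightarrow> bool"
  assumes fin: "\<And>x. finite {y. R x y}" and inf: "infinite {y. R\<^sup>*\<^sup>* a y}"
  shows "\<exists>w. inj w \<and> w 0 = a \<and> (\<forall>k::nat. R (w k) (w (Suc k)))"
proof -
  define Rch where "Rch = (\<lambda>A x. {y. (\<lambda>u v. R u v \<and> v \<notin> A)\<^sup>*\<^sup>* x y})"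
  \<comment> \<open>The clause for \<open>n = 0\<close> makes the chosen sequence start at
    \<open>({}, a)\<close>.\<close>
  have "\<exists>f. \<forall>n. (infinite (Rch (fst (f n)) (snd (f n))) \<and> (n = 0 \<longrightarrow> f n = ({}, a))) \<and>
      (R (snd (f n)) (snd (f (Suc n))) \<and> fst (f (Suc n)) = insert (snd (f n)) (fst (f n)) \<and>
       snd (f (Suc n)) \<notin> fst (f (Suc n)))"
  proof (rule dependent_nat_choice)
    show "\<exists>p. infinite (Rch (fst p) (snd p)) \<and> (0 = (0::nat) \<longrightarrow> p = ({}, a))"
      using inf unfolding Rch_def by (intro exI[of _ "({}, a)"]) simp
    fix p :: "'a set \<times> 'a" and n :: nat
    assume "infinite (Rch (fst p) (snd p)) \<and> (n = 0 \<longrightarrow> p = ({}, a))"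
    then obtain y where "R (snd p) y" "y \<notin> insert (snd p) (fst p)"
        "infinite (Rch (insert (snd p) (fst p)) y)"
      using infinite_reachable_avoiding_step[where R = R and A = "fst p" and x = "snd p"] fin
      unfolding Rch_def by blast
    then show "\<exists>q. (infinite (Rch (fst q) (snd q)) \<and> (Suc n = 0 \<longrightarrow> q = ({}, a))) \<and>
      (R (snd p) (snd q) \<and> fst q = insert (snd p) (fst p) \<and> snd q \<notin> fst q)"
      by (intro exI[of _ "(insert (snd p) (fst p), y)"]) simp
  qed
  then obtain f where f0: "f 0 = ({}, a)"
    and R: "\<And>n. R (snd (f n)) (snd (f (Suc n)))"
    and A: "\<And>n. fst (f (Suc n)) = insert (snd (f n)) (fst (f n))"
    and new: "\<And>n. snd (f (Suc n)) \<notin> fst (f (Suc n))" by blast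
  have mem: "snd (f m) \<in> fst (f (Suc n))" if "m \<le> n" for m n
    using that by (induction n) (auto simp: A le_Suc_eq)
  have "snd (f m) \<noteq> snd (f n)" if "m < n" for m n
    using that mem[of m "n - 1"] new[of "n - 1"] by (cases n) auto
  then have "inj (\<lambda>n. snd (f n))" by (metis injI linorder_neqE_nat)
  then show ?thesis using f0 R by (intro exI[of _ "\<lambda>n. snd (f n)"]) simp
qed

text \<open>Cancel \<open>f\<close> on both sides until one exponent is \<open>0\<close>; a start
  outside the image of \<open>f\<close> can be met only at time \<open>0\<close>. With
  \<open>s = t\<close> this says that an orbit does not repeat, with \<open>s \<noteq> t\<close>
  that orbits are disjoint.\<close>

lemma funpow_inj_on_orbits:
  assumes inj: "inj_on f U" and U: "f ` U \<subseteq> U"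
    and s: "s \<in> U" "s \<notin> f ` U" and t: "t \<in> U" "t \<notin> f ` U"
    and eq: "(f ^^ m) s = (f ^^ n) t"
  shows "m = n \<and> s = t"
  using eq
proof (induction m arbitrary: n)
  have inU: "(f ^^ k) x \<in> U" if "x \<in> U" for k x using that U by (induction k) auto
  { case 0
    then show ?case using inU[OF t(1)] s by (cases n) auto
  next
    case (Suc m)
    show ?case
    proof (cases n)
      case 0
      then show ?thesis using Suc.prems inU[OF s(1)] t by (metis funpow.simps(1,2) id_apply imageI o_apply)
    next
      case (Suc k)
      then have "(f ^^ m) s = (f ^^ k) t"
        using Suc.prems inj inU s t by (auto dest: inj_onD)
      then show ?thesis using Suc.IH Suc by blast
    qed }
qed

section \<open>Flows on the integer line with chords\<close>

locale chord_matching =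
  fixes m :: "int \<Rightarrow> int"
  assumes invol: "m (m i) = i" and no_short: "m i \<noteq> i" "m i \<noteq> i + 1" "m i \<noteq> i - 1"
begin

text \<open>Arcs of the residual network of the flow that sends one unit from \<open>0\<close> along each of
  the two half-lines: a chord can be used in both directions, an edge of the line only
  towards \<open>0\<close>.\<close>

definition residual :: "int \<Rightarrow> int \<Rightarrow> bool" where
  "residual i j \<longleftrightarrow> j = m i \<or> (i \<noteq> 0 \<and> j = i - sgn i)"

lemma no_short_sgn: "m i \<noteq> i - sgn j"
  using no_short[of i] by (auto simp: sgn_if)

text \<open>Line arcs point towards \<open>0\<close>, so everything between \<open>0\<close> and a
  reachable vertex is reachable and the reachable set is an interval around \<open>0\<close>. Every
  vertex also has its chord as a residual arc, so the set is closed under \<open>m\<close>.\<close>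

lemma closed_interval_if_finite_reachable:
  assumes "finite {j. residual\<^sup>*\<^sup>* 0 j}"
  shows "\<exists>c d. c \<le> d \<and> m ` {c..d} \<subseteq> {c..d}"
proof -
  define X where "X = {j. residual\<^sup>*\<^sup>* 0 j}"
  have fin: "finite X" and zero: "0 \<in> X" using assms unfolding X_def by auto
  have step: "j \<in> X" if "i \<in> X" "residual i j" for i j
    using that unfolding X_def by (auto intro: rtranclp.rtrancl_into_rtrancl)
  have down: "i - sgn i \<in> X" if "i \<in> X" for i
    using that step[of i "i - sgn i"] zero by (cases "i = 0") (auto simp: residual_def)
  have pos: "y \<in> X" if "0 \<le> y" "y \<le> x" "x \<in> X" for x y
    using that(2,1,3)
  proof (induction x rule: int_ge_induct)
    case (step x)
    then show ?case using down[of "x + 1"] by (auto simp: sgn_if)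
  qed simp
  have neg: "y \<in> X" if "y \<le> 0" "x \<le> y" "x \<in> X" for x y
    using that(2,1,3)
  proof (induction x rule: int_le_induct)
    case (step x)
    then show ?case using down[of "x - 1"] by (auto simp: sgn_if)
  qed simp
  have mem: "Min X \<in> X" "Max X \<in> X" using fin zero Min_in[of X] Max_in[of X] by blast+
  have "X = {Min X..Max X}"
  proof
    show "X \<subseteq> {Min X..Max X}" using fin by auto
    show "{Min X..Max X} \<subseteq> X"
    proof
      fix y assume "y \<in> {Min X..Max X}"
      then show "y \<in> X" using pos[of y "Max X"] neg[of y "Min X"] mem by (cases "0 \<le> y") auto
    qed
  qed
  moreover have "m ` X \<subseteq> X" using step by (auto simp: residual_def)
  moreover have "Min X \<le> Max X" using fin zero by (meson Max_ge Min_le order_trans)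
  ultimately show ?thesis by metis
qed

text \<open>Augmenting the flow of value 2 along an injective residual ray \<open>w\<close> yields a flow of
  value 3. Its support away from \<open>0\<close> is the graph of the injective function \<open>f\<close>, so its
  three strands are orbits of \<open>f\<close>; the vertices in \<open>E\<close> have both their line edges cancelled.\<close>

lemma three_orbits_if_residual_ray:
  assumes inj: "inj w" and w0: "w 0 = 0" and res: "\<And>k::nat. residual (w k) (w (Suc k))"
  shows "\<exists>r :: nat \<Rightarrow> nat \<Rightarrow> int.
    (\<forall>a n. r a (Suc n) \<in> {r a n - 1, r a n + 1, m (r a n)}) \<and>
    (\<forall>a<3. \<forall>b<3. \<forall>k l. r a k = r b l \<longrightarrow> a = b \<and> k = l)"
proof -
  \<comment> \<open>\<open>A\<close> collects the vertices that the augmenting ray leaves by a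
    chord: there the new flow turns off the line. At all other vertices of \<open>U\<close> it goes
    on outward, so \<open>f\<close> is the successor along a strand.\<close>
  define A where "A = {w k |k. w (Suc k) = m (w k)}"
  define E where "E = {w k |k. k \<ge> 1 \<and> w (Suc k) = w k - sgn (w k) \<and> w (k - 1) = w k + sgn (w k)}"
  define U where "U = {i. i \<noteq> 0} - E"
  define f where "f = (\<lambda>i. if i \<in> A then m i else i + sgn i)"
  have weq: "w k = w l \<longleftrightarrow> k = l" for k l using inj by (simp add: inj_eq)
  have wnz: "w (Suc k) \<noteq> 0" for k using weq[of "Suc k" 0] w0 by simp
  \<comment> \<open>Injectivity forbids going back over the same chord, so the ray continues along
    the line towards \<open>0\<close>.\<close>
  have after_chord: "w (Suc (Suc k)) = w (Suc k) - sgn (w (Suc k))" if "w (Suc k) = m (w k)" for k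
  proof -
    have "w (Suc (Suc k)) \<noteq> m (w (Suc k))" using that invol weq[of "Suc (Suc k)" k] by auto
    then show ?thesis using res[of "Suc k"] by (simp add: residual_def)
  qed
  \<comment> \<open>The ray has cancelled the line edge on the outer side of \<open>i\<close>;
    either it leaves by the chord, and the unit through \<open>i\<close> is diverted there, or it
    also cancels the inner edge.\<close>
  have outward: "i \<in> A \<or> i \<in> E" if ik: "i \<noteq> 0" "w k = i + sgn i" "w (Suc k) = i" for i k
  proof -
    consider "w (Suc (Suc k)) = m i" | "w (Suc (Suc k)) = i - sgn i"
      using res[of "Suc k"] unfolding residual_def ik(3) by blast
    then show ?thesis
    proof cases
      case 1 then show ?thesis using ik unfolding A_def by (metis (mono_tags, lifting) mem_Collect_eq)
    next
      case 2
      then have "i \<in> E" unfolding E_def using ik by (intro CollectI exI[of _ "Suc k"]) auto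
      then show ?thesis by simp
    qed
  qed
  have sgn_out: "i + sgn i - sgn (i + sgn i) = i" if "i \<noteq> 0" for i :: int
    using that by (auto simp: sgn_if)
  have sgn_same: "sgn (i + sgn i) = sgn i" for i :: int by (auto simp: sgn_if)
  \<comment> \<open>Had the ray entered \<open>i + sgn i\<close> by a chord, it would next cancel
    the line edge back to \<open>i\<close>, and \<open>i\<close> would be in \<open>A\<close> or
    \<open>E\<close>. So no vertex receives both a unit over its chord and one along the line, which
    is the core of the injectivity of \<open>f\<close>.\<close>
  have chord_not_out: "i + sgn i \<noteq> w (Suc k)"
    if "i \<noteq> 0" "i \<notin> A" "i \<notin> E" "w (Suc k) = m (w k)" for i k
  proof
    assume eq: "i + sgn i = w (Suc k)"
    then have "w (Suc (Suc k)) = i" using after_chord[OF that(4)] sgn_out[OF that(1)] by simp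
    then show False using outward[OF that(1), of "Suc k"] eq that by simp
  qed
  have fU: "f i \<in> U" if "i \<in> U" for i
  proof (cases "i \<in> A")
    case True
    then obtain k where k: "i = w k" "w (Suc k) = m i" unfolding A_def by auto
    have "m i \<notin> E"
    proof
      assume "m i \<in> E"
      then obtain l where "m i = w l" "l \<ge> 1" "w (l - 1) = w l + sgn (w l)" unfolding E_def by auto
      then have "i = m i + sgn (m i)" using k weq[of "Suc k" l] by auto
      then show False using no_short_sgn[of i "m i"] by linarith
    qed
    then show ?thesis using True k wnz[of k] unfolding U_def f_def by auto
  next
    case False
    have i: "i \<noteq> 0" "i \<notin> E" using that unfolding U_def by auto
    have "i + sgn i \<notin> E"
    proof
      assume "i + sgn i \<in> E"
      then obtain k where "w k = i + sgn i" "w (Suc k) = i"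
        unfolding E_def using sgn_out[OF i(1)] by auto
      then show False using outward[of i k] i False by blast
    qed
    moreover have "i + sgn i \<noteq> 0" using i by (auto simp: sgn_if)
    ultimately show ?thesis using False unfolding U_def f_def by auto
  qed
  have injf: "inj_on f U"
  proof (rule inj_onI)
    have mixed: False if "i \<in> U" "j \<in> U" "f i = f j" "i \<in> A" "j \<notin> A" for i j
    proof -
      obtain k where "i = w k" "w (Suc k) = m i" using \<open>i \<in> A\<close> unfolding A_def by auto
      then show False using chord_not_out[of j k] that unfolding U_def f_def by auto
    qed
    fix i j assume ij: "i \<in> U" "j \<in> U" "f i = f j"
    consider "i \<in> A" "j \<in> A" | "i \<notin> A" "j \<notin> A" using mixed ij by metis
    then show "i = j"
    proof cases
      case 1 then show ?thesis using ij(3) invol unfolding f_def by metis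
    next
      case 2
      then have "i + sgn i = j + sgn j" using ij(3) unfolding f_def by simp
      then show ?thesis using ij(1,2) unfolding U_def by (auto simp: sgn_if split: if_splits)
    qed
  qed
  have w1: "w (Suc 0) = m 0" using res[of 0] w0 by (simp add: residual_def)
  \<comment> \<open>The strands start at the three neighbours \<open>1\<close>, \<open>- 1\<close>
    and \<open>m 0\<close> of \<open>0\<close>. As the ray never returns to \<open>0\<close>, it can
    neither enter \<open>1\<close> or \<open>- 1\<close> by a chord nor pass through them
    inward.\<close>
  have unit: "x \<in> U \<and> x \<notin> f ` U" if x: "x = 1 \<or> x = - 1" for x
  proof -
    have x0: "x - sgn x = 0" using x by auto
    have "x \<notin> E" using x0 wnz unfolding E_def by auto
    moreover have "f i \<noteq> x" if "i \<in> U" for i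
    proof (cases "i \<in> A")
      case True
      then obtain k where k: "i = w k" "w (Suc k) = m (w k)" unfolding A_def by auto
      then show ?thesis using after_chord[OF k(2)] wnz x0 True unfolding f_def by auto
    next
      case False
      then show ?thesis using that x unfolding U_def f_def by (auto simp: sgn_if)
    qed
    then have "x \<notin> f ` U" by (metis imageE)
    moreover have "x \<noteq> 0" using x by auto
    ultimately show ?thesis unfolding U_def by blast
  qed
  have m0: "m 0 \<in> U \<and> m 0 \<notin> f ` U"
  proof -
    have "m 0 \<notin> E"
    proof
      assume "m 0 \<in> E"
      then obtain l where "m 0 = w l" "w (l - 1) = w l + sgn (w l)" unfolding E_def by auto
      then have "0 = m 0 + sgn (m 0)" using w0 w1 weq[of "Suc 0" l] by auto
      then show False using no_short_sgn[of 0 "m 0"] by linarith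
    qed
    moreover have "f i \<noteq> m 0" if "i \<in> U" for i
    proof (cases "i \<in> A")
      case True
      then show ?thesis using that invol unfolding U_def f_def by (metis DiffD1 mem_Collect_eq)
    next
      case False
      then show ?thesis using chord_not_out[of i 0] w0 w1 that unfolding U_def f_def by auto
    qed
    then have "m 0 \<notin> f ` U" by (metis imageE)
    ultimately show ?thesis using no_short(1)[of 0] unfolding U_def by blast
  qed
  define s where "s = (\<lambda>a::nat. if a = 0 then 1 else if a = 1 then - 1 else m 0)"
  have s: "s a \<in> U \<and> s a \<notin> f ` U" for a using unit m0 unfolding s_def by auto
  have s_inj: "a = b" if "a < 3" "b < 3" "s a = s b" for a b
    using that no_short[of 0] unfolding s_def by (auto split: if_splits)
  define r where "r = (\<lambda>a n. (f ^^ n) (s a))"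
  show ?thesis
  proof (intro exI[of _ r] conjI allI impI)
    show "r a (Suc n) \<in> {r a n - 1, r a n + 1, m (r a n)}" for a n
    proof -
      have "r a n \<in> U" unfolding r_def using s fU by (induction n) auto
      then show ?thesis unfolding r_def f_def U_def by (auto simp: sgn_if)
    qed
    fix a b :: nat and k l assume ab: "a < 3" "b < 3" "r a k = r b l"
    then have "k = l \<and> s a = s b"
      using funpow_inj_on_orbits[OF injf _, of "s a" "s b" k l] s fU unfolding r_def by blast
    then show "a = b" "k = l" using s_inj ab by auto
  qed
qed

text \<open>Max-flow min-cut for the flow of value 2: the interval is bounded by the two line edges
  that carry this flow, while the orbits are the strands of a flow of value 3.\<close>

theorem closed_interval_or_three_orbits:
  obtains c d where "c \<le> d" "m ` {c..d} \<subseteq> {c..d}"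
  | r :: "nat \<Rightarrow> nat \<Rightarrow> int" where
    "\<And>a n. r a (Suc n) \<in> {r a n - 1, r a n + 1, m (r a n)}"
    "\<And>a b k l. a < 3 \<Longrightarrow> b < 3 \<Longrightarrow> r a k = r b l \<Longrightarrow> a = b \<and> k = l"
proof (cases "finite {j. residual\<^sup>*\<^sup>* 0 j}")
  case True
  then show ?thesis using closed_interval_if_finite_reachable that(1) by blast
next
  case False
  have "finite {j. residual i j}" for i
    by (rule finite_subset[of _ "{m i, i - sgn i}"]) (auto simp: residual_def)
  then obtain w where "inj w" "w 0 = 0" "\<And>k::nat. residual (w k) (w (Suc k))"
    using injective_path_if_infinite_reachable False by metis
  from three_orbits_if_residual_ray[OF this] show ?thesis using that(2) by metis
qed

end

section \<open>The circle as a line plus a point\<close>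

definition stereo_inv :: "real \<Rightarrow> complex" where
  "stereo_inv t = Complex ((t\<^sup>2 - 1) / (t\<^sup>2 + 1)) (2 * t / (t\<^sup>2 + 1))"

definition stereo :: "complex \<Rightarrow> real" where
  "stereo z = Im z / (1 - Re z)"

lemma sq_plus_one_nonzero: "t\<^sup>2 + 1 \<noteq> (0::real)"
  by (metis add.commute power_one sum_power2_eq_zero_iff zero_neq_one)

lemma stereo_inv_in_sphere: "stereo_inv t \<in> sphere 0 1"
proof -
  have "((t\<^sup>2 - 1) / (t\<^sup>2 + 1))\<^sup>2 + (2 * t / (t\<^sup>2 + 1))\<^sup>2 = ((t\<^sup>2 - 1)\<^sup>2 + (2 * t)\<^sup>2) / (t\<^sup>2 + 1)\<^sup>2"
    by (simp add: power_divide add_divide_distrib)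
  also have "(t\<^sup>2 - 1)\<^sup>2 + (2 * t)\<^sup>2 = (t\<^sup>2 + 1)\<^sup>2"
    by (simp add: power2_eq_square algebra_simps)
  finally show ?thesis using sq_plus_one_nonzero[of t]
    by (simp add: stereo_inv_def cmod_def)
qed

lemma Re_stereo_inv: "1 - Re (stereo_inv t) = 2 / (t\<^sup>2 + 1)"
  using sq_plus_one_nonzero[of t] by (simp add: stereo_inv_def field_simps)

lemma stereo_stereo_inv: "stereo (stereo_inv t) = t"
  using sq_plus_one_nonzero[of t] unfolding stereo_def Re_stereo_inv
  by (simp add: stereo_inv_def)

lemma stereo_inv_neq_1: "stereo_inv t \<noteq> 1"
  using Re_stereo_inv[of t] sq_plus_one_nonzero[of t] by auto

lemma sphere_Re_less_1:
  assumes "z \<in> sphere (0::complex) 1" "z \<noteq> 1"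
  shows "Re z < 1"
proof -
  have sq: "(Re z)\<^sup>2 + (Im z)\<^sup>2 = 1"
    using assms(1) by (simp add: cmod_def)
  have "Re z \<le> 1" using complex_Re_le_cmod[of z] assms(1) by simp
  moreover have "Re z \<noteq> 1" using sq assms(2) by (auto simp: complex_eq_iff)
  ultimately show ?thesis by simp
qed

lemma stereo_sq:
  assumes "z \<in> sphere (0::complex) 1" "z \<noteq> 1"
  shows "(stereo z)\<^sup>2 + 1 = 2 / (1 - Re z)"
proof -
  define d where "d = 1 - Re z"
  have sq: "(Im z)\<^sup>2 = d * (2 - d)"
    using assms(1) by (simp add: d_def cmod_def power2_eq_square algebra_simps)
  have "d \<noteq> 0" using sphere_Re_less_1[OF assms] by (simp add: d_def)
  then show ?thesis unfolding stereo_def power_divide sq d_def[symmetric]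
    by (simp add: power2_eq_square field_simps)
qed

lemma stereo_inv_stereo:
  assumes "z \<in> sphere (0::complex) 1" "z \<noteq> 1"
  shows "stereo_inv (stereo z) = z"
proof -
  have nz: "1 - Re z \<noteq> 0" using sphere_Re_less_1[OF assms] by simp
  have "1 - Re (stereo_inv (stereo z)) = 1 - Re z"
    unfolding Re_stereo_inv stereo_sq[OF assms] using nz by simp
  moreover have "Im (stereo_inv (stereo z)) = Im z"
    using nz unfolding stereo_inv_def stereo_sq[OF assms] by (simp add: stereo_def)
  ultimately show ?thesis by (simp add: complex_eq_iff)
qed

lemma continuous_on_stereo_inv: "continuous_on UNIV stereo_inv"
  unfolding stereo_inv_def Complex_eq
  by (intro continuous_intros) (use sq_plus_one_nonzero in auto)

lemma continuous_on_stereo: "continuous_on (sphere 0 1 - {1}) stereo"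
  unfolding stereo_def
  by (intro continuous_intros) (use sphere_Re_less_1 in fastforce)

lemma dist_stereo_inv: "(dist (stereo_inv t) 1)\<^sup>2 = 4 / (t\<^sup>2 + 1)"
proof -
  let ?z = "stereo_inv t"
  have "(Re ?z)\<^sup>2 + (Im ?z)\<^sup>2 = 1" using stereo_inv_in_sphere[of t] by (simp add: cmod_def)
  then have "(dist ?z 1)\<^sup>2 = 2 * (1 - Re ?z)"
    unfolding dist_norm cmod_power2 by (simp add: power2_eq_square algebra_simps)
  then show ?thesis unfolding Re_stereo_inv by simp
qed

text \<open>Rotate the circle so that \<open>x\<close> corresponds to \<open>1\<close>, then project
  from there. Continuity at \<open>x\<close> turns into convergence of \<open>g\<close> to
  \<open>x\<close> in both directions of the line.\<close>

lemma circle_minus_point: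
  assumes "circle_in X C" "x \<in> C"
  obtains g :: "real \<Rightarrow> 'b" where "continuous_map euclideanreal X g" "inj g" "range g = C - {x}"
    "\<And>U. openin X U \<Longrightarrow> x \<in> U \<Longrightarrow> \<exists>B. \<forall>t. \<bar>t\<bar> > B \<longrightarrow> g t \<in> U"
proof -
  let ?S = "sphere (0::complex) 1"
  obtain h where h: "homeomorphic_map (top_of_set ?S) (subtopology X C) h"
    using assms(1) unfolding circle_in_def homeomorphic_space by blast
  have CX: "C \<subseteq> topspace X" using assms(1) unfolding circle_in_def by blast
  have injh: "inj_on h ?S" using homeomorphic_imp_injective_map[OF h] by simp
  have imh: "h ` ?S = C" using homeomorphic_imp_surjective_map[OF h] CX by (simp add: inf_absorb2)
  have conth: "continuous_map (top_of_set ?S) X h"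
    using homeomorphic_imp_continuous_map[OF h] continuous_map_in_subtopology by blast
  obtain p where p: "p \<in> ?S" "h p = x" using imh assms(2) by blast
  have p0: "p \<noteq> 0" "cmod p = 1" using p by auto
  define \<phi> where "\<phi> = (\<lambda>z. h (p * z))"
  have rot: "p * z \<in> ?S \<longleftrightarrow> z \<in> ?S" for z using p0 by (simp add: norm_mult)
  have cont\<phi>: "continuous_map (top_of_set ?S) X \<phi>"
  proof -
    have "continuous_map (top_of_set ?S) (top_of_set ?S) (\<lambda>z. p * z)"
      using rot by (auto intro!: continuous_intros)
    then show ?thesis using conth continuous_map_compose[of _ _ "\<lambda>z. p * z" X h]
      unfolding \<phi>_def o_def by blast
  qed
  have inj\<phi>: "z = z'" if "z \<in> ?S" "z' \<in> ?S" "\<phi> z = \<phi> z'" for z z'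
    using that injh rot p0 unfolding \<phi>_def by (auto dest: inj_onD)
  have \<phi>1: "\<phi> 1 = x" using p by (simp add: \<phi>_def)
  have im\<phi>: "\<phi> ` ?S = C"
  proof -
    have "(\<lambda>z. p * z) ` ?S = ?S"
    proof
      show "?S \<subseteq> (\<lambda>z. p * z) ` ?S"
      proof
        fix z assume "z \<in> ?S"
        then show "z \<in> (\<lambda>z. p * z) ` ?S"
          using p0 rot[of "z / p"] by (intro image_eqI[of _ _ "z / p"]) auto
      qed
    qed (use rot in blast)
    then show ?thesis using imh unfolding \<phi>_def by (metis image_image)
  qed
  define g where "g = (\<lambda>t. \<phi> (stereo_inv t))"
  show ?thesis
  proof (rule that[of g])
    have "continuous_map euclideanreal (top_of_set ?S) stereo_inv"
      using continuous_on_stereo_inv stereo_inv_in_sphere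
      by (auto simp: continuous_map_in_subtopology)
    then show "continuous_map euclideanreal X g"
      using cont\<phi> continuous_map_compose[of _ _ stereo_inv X \<phi>] unfolding g_def o_def by blast
    show "inj g"
      unfolding g_def by (metis inj\<phi> injI stereo_inv_in_sphere stereo_stereo_inv)
    show "range g = C - {x}"
    proof
      have "g t \<noteq> x" for t
        using inj\<phi>[of "stereo_inv t" 1] \<phi>1 stereo_inv_in_sphere[of t] stereo_inv_neq_1[of t]
        unfolding g_def by auto
      then show "range g \<subseteq> C - {x}" using im\<phi> stereo_inv_in_sphere unfolding g_def by blast
      show "C - {x} \<subseteq> range g"
      proof
        fix y assume y: "y \<in> C - {x}"
        then obtain z where z: "z \<in> ?S" "y = \<phi> z" using im\<phi> by blast
        then have "z \<noteq> 1" using y \<phi>1 by auto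
        then show "y \<in> range g" using z stereo_inv_stereo unfolding g_def by (metis rangeI)
      qed
    qed
    fix U assume U: "openin X U" "x \<in> U"
    then have "openin (top_of_set ?S) {z \<in> ?S. \<phi> z \<in> U}"
      using openin_continuous_map_preimage[OF cont\<phi>] by simp
    then obtain e where e: "e > 0" "\<And>z. z \<in> ?S \<Longrightarrow> dist z 1 < e \<Longrightarrow> \<phi> z \<in> U"
    proof -
      have "1 \<in> {z \<in> ?S. \<phi> z \<in> U}" using \<phi>1 U(2) by simp
      then show ?thesis
        using that \<open>openin (top_of_set ?S) {z \<in> ?S. \<phi> z \<in> U}\<close>
        unfolding openin_euclidean_subtopology_iff by blast
    qed
    \<comment> \<open>The squared distance to \<open>1\<close> is
      \<open>4 / (t\<^sup>2 + 1)\<close>, which is below \<open>e\<^sup>2\<close> once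
      \<open>\<bar>t\<bar> > 2 / e\<close>.\<close>
    show "\<exists>B. \<forall>t. \<bar>t\<bar> > B \<longrightarrow> g t \<in> U"
    proof (intro exI[of _ "2 / e"] allI impI)
      fix t assume t: "\<bar>t\<bar> > 2 / e"
      then have "2 < \<bar>t\<bar> * e" using e by (simp add: field_simps)
      then have "2\<^sup>2 < (\<bar>t\<bar> * e)\<^sup>2" by (intro power_strict_mono) auto
      then have "4 < (t\<^sup>2 + 1) * e\<^sup>2" using e by (simp add: power_mult_distrib algebra_simps add_strict_increasing2)
      moreover have "t\<^sup>2 + 1 > 0" by (simp add: add_nonneg_pos)
      ultimately have "(dist (stereo_inv t) 1)\<^sup>2 < e\<^sup>2"
        unfolding dist_stereo_inv by (simp add: field_simps)
      then have "dist (stereo_inv t) 1 < e" using e by (simp add: power_less_imp_less_base)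
      then show "g t \<in> U" using e(2) stereo_inv_in_sphere unfolding g_def by blast
    qed
  qed
qed

text \<open>A continuous bijection from the compact circle onto a Hausdorff space is a
  homeomorphism; hence the hypothesis \<open>haus\<close> in place of continuity of the inverse.
  Continuity is tested on the generating sets \<open>\<B>\<close> only.\<close>

lemma circle_in_line_plus_point:
  fixes g :: "real \<Rightarrow> 'b" and \<B> :: "'b set set"
  defines "X \<equiv> topology_generated_by \<B>"
  assumes open_g: "\<And>U. U \<in> \<B> \<Longrightarrow> open (g -` U)" and gX: "range g \<subseteq> \<Union>\<B>"
    and x: "x \<in> \<Union>\<B>" "x \<notin> range g" and inj: "inj g"
    and lim: "\<And>U. U \<in> \<B> \<Longrightarrow> x \<in> U \<Longrightarrow> \<exists>B. \<forall>t. \<bar>t\<bar> > B \<longrightarrow> g t \<in> U"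
    and haus: "Hausdorff_space (subtopology X (insert x (range g)))"
  shows "circle_in X (insert x (range g))"
proof -
  let ?S = "sphere (0::complex) 1"
  let ?C = "insert x (range g)"
  define \<phi> where "\<phi> = (\<lambda>z. if z = 1 then x else g (stereo z))"
  have topX: "topspace X = \<Union>\<B>" unfolding X_def by simp
  have openpre: "openin (top_of_set ?S) (\<phi> -` U \<inter> ?S)" if U: "U \<in> \<B>" for U
  proof -
    have "openin (top_of_set (?S - {1})) ((?S - {1}) \<inter> stereo -` (g -` U))"
      using continuous_openin_preimage_gen[OF continuous_on_stereo open_g[OF U]] .
    moreover have "openin (top_of_set ?S) (?S - {1})"
      by (metis openin_delete openin_subtopology_self)
    ultimately have op: "openin (top_of_set ?S) ((?S - {1}) \<inter> stereo -` (g -` U))"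
      by (rule openin_trans)
    show ?thesis
    proof (cases "x \<in> U")
      case False
      then have "\<phi> -` U \<inter> ?S = (?S - {1}) \<inter> stereo -` (g -` U)"
        unfolding \<phi>_def by (auto split: if_splits)
      then show ?thesis using op by simp
    next
      case True
      then obtain B where B: "\<And>t. \<bar>t\<bar> > B \<Longrightarrow> g t \<in> U" using lim[OF U] by blast
      \<comment> \<open>Since \<open>1 - Re z \<le> dist z 1\<close>, the identity
        \<open>stereo_sq\<close> turns \<open>dist z 1 < e\<close> into
        \<open>(stereo z)\<^sup>2 + 1 > B\<^sup>2 + 1\<close>.\<close>
      define e where "e = 2 / (B\<^sup>2 + 1)"
      have Bpos: "B\<^sup>2 + 1 > 0" by (simp add: add_nonneg_pos)
      have epos: "e > 0" unfolding e_def using Bpos by simp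
      have near: "\<phi> z \<in> U" if z: "z \<in> ?S" "dist z 1 < e" for z
      proof (cases "z = 1")
        case False
        have lt: "0 < 1 - Re z" using sphere_Re_less_1[OF z(1) False] by simp
        have "1 - Re z \<le> dist z 1"
          using abs_Re_le_cmod[of "z - 1"] by (simp add: dist_norm)
        then have "1 - Re z < e" using z by simp
        then have "2 / (1 - Re z) > B\<^sup>2 + 1" using lt Bpos unfolding e_def by (simp add: field_simps)
        then have "(stereo z)\<^sup>2 > B\<^sup>2" using stereo_sq[OF z(1) False] by simp
        then have "\<bar>stereo z\<bar> > B" by (metis abs_le_square_iff abs_ge_self le_less_trans linorder_not_le)
        then show ?thesis using B False unfolding \<phi>_def by simp
      qed (use True in \<open>simp add: \<phi>_def\<close>)
      have "\<phi> -` U \<inter> ?S = ((?S - {1}) \<inter> stereo -` (g -` U)) \<union> (?S \<inter> ball 1 e)"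
        using near True epos unfolding \<phi>_def by (auto simp: dist_commute split: if_splits)
      then show ?thesis using op by (simp add: openin_Un openin_open_Int)
    qed
  qed
  have im: "\<phi> ` ?S = ?C"
  proof
    show "\<phi> ` ?S \<subseteq> ?C" unfolding \<phi>_def by auto
    show "?C \<subseteq> \<phi> ` ?S"
    proof
      fix y assume "y \<in> ?C"
      then consider "y = x" | t where "y = g t" by blast
      then show "y \<in> \<phi> ` ?S"
      proof cases
        case 1
        then show ?thesis unfolding \<phi>_def by (intro image_eqI[of _ _ 1]) auto
      next
        case 2
        then show ?thesis unfolding \<phi>_def
          by (intro image_eqI[of _ _ "stereo_inv t"])
             (auto simp: stereo_inv_neq_1 stereo_stereo_inv stereo_inv_in_sphere[simplified])
      qed
    qed
  qed
  have CX: "?C \<subseteq> topspace X" using topX gX x by blast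
  have "continuous_map (top_of_set ?S) X \<phi>"
    unfolding X_def
  proof (rule continuous_on_generated_topo)
    show "\<phi> ` topspace (top_of_set ?S) \<subseteq> \<Union>\<B>" using im CX topX by simp
  qed (use openpre in simp)
  then have cont: "continuous_map (top_of_set ?S) (subtopology X ?C) \<phi>"
    using im by (auto simp: continuous_map_in_subtopology)
  have "inj_on \<phi> ?S"
  proof (rule inj_onI)
    fix z z' assume z: "z \<in> ?S" "z' \<in> ?S" "\<phi> z = \<phi> z'"
    then consider "z = 1" "z' = 1" | "z \<noteq> 1" "z' \<noteq> 1"
      using x(2) unfolding \<phi>_def by (metis rangeI)
    then show "z = z'"
    proof cases
      case 2
      then have "stereo z = stereo z'" using z(3) inj unfolding \<phi>_def by (auto dest: injD)
      then show ?thesis using stereo_inv_stereo z 2 by metis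
    qed simp
  qed
  then have "homeomorphic_map (top_of_set ?S) (subtopology X ?C) \<phi>"
    using im CX haus cont
    by (intro continuous_imp_homeomorphic_map) (auto simp: compact_space_subtopology inf_absorb2)
  then show ?thesis
    unfolding circle_in_def using CX homeomorphic_map_imp_homeomorphic_space by blast
qed

section \<open>Enumeration of locally finite sets of reals in increasing order\<close>

lemma enumerate_locally_finite_upwards:
  fixes T :: "real set"
  assumes fin: "\<And>a b. finite (T \<inter> {a..b})" and unb: "\<And>s. \<exists>t\<in>T. t > s" and a: "a \<in> T"
  obtains f :: "nat \<Rightarrow> real" where "f 0 = a" "strict_mono f" "range f = T \<inter> {a..}"
    "\<And>n. T \<inter> {f n<..<f (Suc n)} = {}"
proof -
  have step: "\<exists>u\<in>T. u > s \<and> T \<inter> {s<..<u} = {}" for s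
  proof -
    obtain t where t: "t \<in> T" "t > s" using unb by blast
    let ?F = "T \<inter> {s<..t}"
    have finF: "finite ?F" by (rule finite_subset[OF _ fin[of s t]]) auto
    have "Min ?F \<in> ?F" using finF t by (intro Min_in) auto
    moreover have "u \<ge> Min ?F" if "u \<in> T" "s < u" for u
    proof (cases "u \<le> t")
      case True then show ?thesis using finF that by (intro Min_le) auto
    next
      case False then show ?thesis using \<open>Min ?F \<in> ?F\<close> by simp
    qed
    ultimately show ?thesis by (intro bexI[of _ "Min ?F"]) force+
  qed
  then obtain nxt where nxt: "\<And>s. nxt s \<in> T" "\<And>s. nxt s > s" "\<And>s. T \<inter> {s<..<nxt s} = {}"
    by metis
  define f where "f = (\<lambda>n. (nxt ^^ n) a)"
  have f0: "f 0 = a" and fS: "f (Suc n) = nxt (f n)" for n unfolding f_def by auto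
  have mono: "strict_mono f" by (rule strict_monoI_Suc) (simp add: fS nxt)
  have fT: "f n \<in> T" for n by (cases n) (auto simp: f0 fS nxt a)
  have fa: "f n \<ge> a" for n using mono f0 by (metis strict_mono_less_eq zero_le)
  have "t \<in> range f" if t: "t \<in> T" "t \<ge> a" for t
  proof -
    have "\<exists>n. f n > t"
    proof (rule ccontr)
      assume "\<not> ?thesis"
      then have "range f \<subseteq> T \<inter> {a..t}" using fT fa by (auto simp: not_less)
      then have "finite (range f)" using fin finite_subset by blast
      then show False using mono strict_mono_imp_inj_on finite_imageD by blast
    qed
    define n where "n = (LEAST n. f n > t)"
    have n: "f n > t" using \<open>\<exists>n. f n > t\<close> unfolding n_def by (rule LeastI_ex)
    then have "n \<noteq> 0" using t f0 by (metis not_less)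
    then obtain k where k: "n = Suc k" using not0_implies_Suc by blast
    have "f k \<le> t" using not_less_Least[of k "\<lambda>n. f n > t"] k unfolding n_def by (simp add: not_less)
    moreover have "t \<notin> {f k<..<nxt (f k)}" using nxt(3) t by blast
    ultimately have "t = f k" using n k fS by auto
    then show ?thesis by blast
  qed
  then have "range f = T \<inter> {a..}" using fT fa by auto
  then show ?thesis using that f0 mono fS nxt(3) by metis
qed

text \<open>Enumerate upwards from some \<open>a\<close>, do the same for the mirrored set from
  \<open>- a\<close>, and glue at index \<open>0\<close>. Applied to the parameters of the vertices
  on a circle without its end, this supplies the indexing by \<open>int\<close>.\<close>

lemma enumerate_locally_finite:
  fixes T :: "real set"
  assumes fin: "\<And>a b. finite (T \<inter> {a..b})"
    and up: "\<And>s. \<exists>t\<in>T. t > s" and down: "\<And>s. \<exists>t\<in>T. t < s"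
  obtains f :: "int \<Rightarrow> real" where "strict_mono f" "range f = T"
    "\<And>i. T \<inter> {f i<..<f (i + 1)} = {}"
proof -
  obtain a where a: "a \<in> T" using up by blast
  obtain p where p: "p 0 = a" "strict_mono p" "range p = T \<inter> {a..}" "\<And>n. T \<inter> {p n<..<p (Suc n)} = {}"
    using enumerate_locally_finite_upwards[OF fin up a] by metis
  let ?T = "uminus ` T"
  have "finite (?T \<inter> {x..y})" for x y
  proof (rule finite_subset)
    show "?T \<inter> {x..y} \<subseteq> uminus ` (T \<inter> {-y..-x})" by force
  qed (use fin in auto)
  moreover have "\<exists>t\<in>?T. t > s" for s using down[of "- s"] by force
  moreover have "- a \<in> ?T" using a by blast
  ultimately obtain q where q: "q 0 = - a" "strict_mono q" "range q = ?T \<inter> {- a..}"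
      "\<And>n. ?T \<inter> {q n<..<q (Suc n)} = {}"
    using enumerate_locally_finite_upwards[of ?T] by metis
  define f where "f = (\<lambda>i. if i \<ge> 0 then p (nat i) else - q (nat (- i)))"
  have qneg: "f (- int n) = - q n" for n
    using p(1) q(1) unfolding f_def by (cases n) (auto simp: nat_add_distrib)
  have ppos: "f (int n) = p n" for n unfolding f_def by simp
  have step: "f i < f (i + 1) \<and> T \<inter> {f i<..<f (i + 1)} = {}" for i
  proof (cases "i \<ge> 0")
    case True
    then obtain n where n: "i = int n" using zero_le_imp_eq_int by blast
    have "f (i + 1) = p (Suc n)" using ppos[of "Suc n"] n by (simp add: add.commute)
    then show ?thesis using p ppos n by (simp add: strict_mono_less)
  next
    case False
    then obtain n where n: "i = - int (Suc n)" using negative_zless_0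
      by (metis int_cases not_less of_nat_0_le_iff)
    then have i1: "i + 1 = - int n" by simp
    have "q n < q (Suc n)" using q(2) by (simp add: strict_mono_less)
    moreover have "T \<inter> {- q (Suc n)<..<- q n} = {}"
    proof (rule ccontr)
      assume "T \<inter> {- q (Suc n)<..<- q n} \<noteq> {}"
      then obtain t where "t \<in> T" "- q (Suc n) < t" "t < - q n" by auto
      then have "- t \<in> ?T \<inter> {q n<..<q (Suc n)}" by auto
      then show False using q(4) by blast
    qed
    ultimately show ?thesis unfolding i1 qneg[of n] unfolding n qneg[of "Suc n"] by simp
  qed
  show ?thesis
  proof (rule that[of f])
    show "strict_mono f"
    proof (rule strict_monoI)
      fix i j :: int assume "i < j"
      then show "f i < f j"
      proof (induction j rule: int_gr_induct)
        case (step j) then show ?case using \<open>\<And>i. f i < f (i + 1) \<and> _\<close> by (meson less_trans)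
      qed (use step in blast)
    qed
    show "range f = T"
    proof
      show "range f \<subseteq> T"
      proof
        fix y assume "y \<in> range f"
        then obtain i where i: "y = f i" by blast
        show "y \<in> T"
        proof (cases "i \<ge> 0")
          case True then show ?thesis using i p(3) unfolding f_def by auto
        next
          case False
          then have "- y \<in> ?T" using i q(3) unfolding f_def by auto
          then show ?thesis by force
        qed
      qed
      show "T \<subseteq> range f"
      proof
        fix t assume t: "t \<in> T"
        show "t \<in> range f"
        proof (cases "t \<ge> a")
          case True
          then obtain n where "t = p n" using t p(3) by auto
          then show ?thesis using ppos by (metis rangeI)
        next
          case False
          then have "- t \<in> range q" using t q(3) by auto
          then obtain n where "t = - q n" by (metis imageE minus_minus)
          then show ?thesis using qneg by (metis rangeI)
        qed
      qed
    qed
  qed (use step in blast)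
qed

section \<open>Ends and the Freudenthal compactification\<close>

lemma simple_graph_edge:
  assumes "simple_graph G" "{u, v} \<in> edges G"
  shows "u \<noteq> v" "u \<in> verts G" "v \<in> verts G"
  using assms unfolding simple_graph_def by fastforce+

lemma component_subset: "K \<in> components_of_graph (delete_verts G S) \<Longrightarrow> K \<subseteq> verts G - S"
  unfolding components_of_graph_def reachable_def delete_verts_def by auto

lemma component_closed:
  assumes "simple_graph G" "K \<in> components_of_graph (delete_verts G S)"
    and "u \<in> K" "{u, v} \<in> edges G" "v \<notin> S"
  shows "v \<in> K"
proof -
  have "u \<notin> S" using component_subset assms(2,3) by fastforce
  then have "{u, v} \<in> edges (delete_verts G S)" "v \<in> verts (delete_verts G S)"
    using assms simple_graph_edge(3) unfolding delete_verts_def by auto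
  then show ?thesis
    using assms(2,3) unfolding components_of_graph_def reachable_def
    by (auto intro: rtranclp.rtrancl_into_rtrancl)
qed

lemma reachable_sym: "reachable G u v \<Longrightarrow> reachable G v u"
proof -
  assume r: "reachable G u v"
  have "symp (\<lambda>x y. {x, y} \<in> edges G)" by (auto simp: symp_def insert_commute)
  then have "symp (\<lambda>x y. {x, y} \<in> edges G)\<^sup>*\<^sup>*" by (rule symp_rtranclp)
  then show ?thesis using r unfolding reachable_def by (auto dest: sympD)
qed

lemma reachable_trans: "reachable G u v \<Longrightarrow> reachable G v w \<Longrightarrow> reachable G u w"
  unfolding reachable_def by auto

lemma component_eqI:
  assumes "K \<in> components_of_graph G" "L \<in> components_of_graph G" "x \<in> K" "x \<in> L"
  shows "K = L"
proof -
  obtain a b where K: "K = {u. reachable G a u}" and L: "L = {u. reachable G b u}"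
    using assms(1,2) unfolding components_of_graph_def by blast
  have "reachable G a x" "reachable G b x" using assms(3,4) K L by auto
  then have "reachable G a u \<longleftrightarrow> reachable G b u" for u
    by (meson reachable_sym reachable_trans)
  then show ?thesis using K L by simp
qed

text \<open>Being injective, a ray meets the finite set \<open>S\<close> only finitely often, and
  the part after its last visit is connected.\<close>

lemma ray_tail_in_component:
  assumes "simple_graph G" "ray G r" "finite S"
  shows "\<exists>K\<in>components_of_graph (delete_verts G S). has_tail_in r K"
proof -
  have inj: "inj r" and edge: "\<And>n. {r n, r (Suc n)} \<in> edges G" using assms(2) unfolding ray_def by auto
  have "finite (r -` S)" using finite_vimageI[OF assms(3) inj] .
  then obtain N where N: "\<And>n. n \<ge> N \<Longrightarrow> r n \<notin> S"
    by (metis finite_nat_iff_bounded_le atMost_iff not_less_eq_eq subset_iff vimageI)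
  let ?H = "delete_verts G S"
  have edgeH: "{r n, r (Suc n)} \<in> edges ?H" if "n \<ge> N" for n
    using that N[of n] N[of "Suc n"] edge unfolding delete_verts_def by auto
  have vertH: "r n \<in> verts ?H" if "n \<ge> N" for n
    using that N[of n] simple_graph_edge(2)[OF assms(1) edge[of n]] unfolding delete_verts_def by auto
  have "reachable ?H (r N) (r n)" if "n \<ge> N" for n
    using that
  proof (induction n rule: dec_induct)
    case base then show ?case using vertH unfolding reachable_def by simp
  next
    case (step n)
    then show ?case using edgeH[of n] vertH[of "Suc n"] unfolding reachable_def
      by (auto intro: rtranclp.rtrancl_into_rtrancl)
  qed
  then have "has_tail_in r {u. reachable ?H (r N) u}" unfolding has_tail_in_def by auto
  then show ?thesis using vertH[of N] unfolding components_of_graph_def by blast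
qed

lemma ray_equiv_refl:
  assumes "simple_graph G" "ray G r"
  shows "(r, r) \<in> ray_equiv G"
  using ray_tail_in_component[OF assms] assms(2) unfolding ray_equiv_def by auto

lemma ray_in_unique_end:
  assumes "simple_graph G" "ends G = {\<omega>}" "ray G r"
  shows "r \<in> \<omega>"
proof -
  have "ray_equiv G `` {r} \<in> ends G" using assms(3) unfolding ends_def by (auto intro: quotientI)
  then show ?thesis using assms(2) ray_equiv_refl[OF assms(1,3)] by auto
qed

text \<open>Every ray of the end shares a component with one fixed representative, and distinct
  components are disjoint, so the component of the representative serves all of them.\<close>

lemma end_lives_in_component:
  assumes "simple_graph G" "\<omega> \<in> ends G" "finite S" "S \<subseteq> verts G"
  obtains K where "K \<in> components_of_graph (delete_verts G S)" "lives_in \<omega> K"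
proof -
  obtain r where r: "ray G r" "\<omega> = ray_equiv G `` {r}"
    using assms(2) unfolding ends_def by (auto elim: quotientE)
  obtain K where K: "K \<in> components_of_graph (delete_verts G S)" "has_tail_in r K"
    using ray_tail_in_component[OF assms(1) r(1) assms(3)] by blast
  have "has_tail_in s K" if s: "s \<in> \<omega>" for s
  proof -
    obtain L where L: "L \<in> components_of_graph (delete_verts G S)" "has_tail_in r L" "has_tail_in s L"
      using s assms(3,4) unfolding r(2) ray_equiv_def by blast
    obtain a b where "\<forall>n\<ge>a. r n \<in> K" "\<forall>n\<ge>b. r n \<in> L" using K(2) L(2) unfolding has_tail_in_def by blast
    then have "r (max a b) \<in> K" "r (max a b) \<in> L" by auto
    then have "K = L" using component_eqI K(1) L(1) by metis
    then show ?thesis using L(3) by simp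
  qed
  then show ?thesis using that K(1) unfolding lives_in_def by blast
qed

definition spanning_double_ray :: "'a ugraph \<Rightarrow> (int \<Rightarrow> 'a) \<Rightarrow> bool" where
  "spanning_double_ray G D \<longleftrightarrow> inj D \<and> range D = verts G \<and> (\<forall>i. {D i, D (i + 1)} \<in> edges G)"

text \<open>Labels a point by the cell that contains it: \<open>{v}\<close> for a vertex
  \<open>v\<close>, the edge itself for an inner point of an edge, the empty set for an end. The
  label is locally constant inside edges, so connectedness of an interval of parameters confines it
  to one edge.\<close>

fun support :: "'a point \<Rightarrow> 'a set" where
  "support (Pt f) = {w. f w \<noteq> 0}"
| "support (End \<omega>) = {}"

lemma support_vert_pt [simp]: "support (vert_pt v) = {v}"
  unfolding vert_pt_def by (auto simp: indicator_def)

lemma support_edge_pt: "0 < t \<Longrightarrow> t < 1 \<Longrightarrow> support (edge_pt u v t) = {u, v}"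
  unfolding edge_pt_def by (auto simp: indicator_def)

lemma vert_pt_eq_iff [simp]: "vert_pt u = vert_pt v \<longleftrightarrow> u = v"
  by (metis support_vert_pt singleton_inject)

lemma edge_pt_commute: "edge_pt u v t = edge_pt v u (1 - t)"
  unfolding edge_pt_def by auto

lemma edge_pt_0 [simp]: "edge_pt u v 0 = vert_pt u"
  unfolding edge_pt_def vert_pt_def by simp

lemma edge_pt_1 [simp]: "edge_pt u v 1 = vert_pt v"
  unfolding edge_pt_def vert_pt_def by simp

lemma pt_neq_End [simp]: "edge_pt u v t \<noteq> End \<omega>" "vert_pt u \<noteq> End \<omega>"
  "End \<omega> \<noteq> edge_pt u v t" "End \<omega> \<noteq> vert_pt u"
  unfolding edge_pt_def vert_pt_def by auto

lemma edge_pt_neq_vert_pt: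
  assumes "0 < t" "t < 1" "u \<noteq> v"
  shows "edge_pt u v t \<noteq> vert_pt w"
  using support_edge_pt[OF assms(1,2), of u v] assms(3)
  by (metis doubleton_eq_iff insert_absorb2 support_vert_pt)

lemma edge_pt_eq_edge_pt:
  assumes "edge_pt x y s = edge_pt u v r" "x \<noteq> y" "0 < s" "s < 1" "0 < r" "r < 1"
  shows "x = u \<and> y = v \<and> s = r \<or> x = v \<and> y = u \<and> s = 1 - r"
proof -
  have "{x, y} = {u, v}" using support_edge_pt assms by metis
  then consider "x = u" "y = v" | "x = v" "y = u" by (metis doubleton_eq_iff)
  then show ?thesis
  proof cases
    case 1
    then show ?thesis using assms(1,2) unfolding edge_pt_def
      by (auto dest!: fun_cong[where x = y])
  next
    case 2
    then show ?thesis using assms(1,2) unfolding edge_pt_def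
      by (auto dest!: fun_cong[where x = y])
  qed
qed

section \<open>Generating open sets of the compactification\<close>

definition freudenthal_base :: "'a ugraph \<Rightarrow> 'a point set set" where
  "freudenthal_base G =
     {open_segment_of_edge u v a b |u v a b. {u, v} \<in> edges G \<and> 0 \<le> a \<and> a < b \<and> b \<le> 1} \<union>
     {vert_nbhd G v d |v d. v \<in> verts G \<and> (\<forall>w. 0 < d w \<and> d w \<le> 1)} \<union>
     {end_nbhd G S K \<epsilon> |S K \<epsilon> \<omega>. finite S \<and> S \<subseteq> verts G \<and>
        K \<in> components_of_graph (delete_verts G S) \<and>
        \<omega> \<in> ends G \<and> lives_in \<omega> K \<and> 0 < \<epsilon> \<and> \<epsilon> \<le> 1}"

lemma freudenthal_eq: "freudenthal G = topology_generated_by (freudenthal_base G)"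
  unfolding freudenthal_def freudenthal_base_def ..

lemma freudenthal_base_cases [consumes 1, case_names segment vertex at_end]:
  assumes "U \<in> freudenthal_base G"
  obtains u v a b where "U = open_segment_of_edge u v a b" "{u, v} \<in> edges G" "0 \<le> a" "a < b" "b \<le> 1"
  | v d where "U = vert_nbhd G v d" "v \<in> verts G" "\<And>w. 0 < d w" "\<And>w. d w \<le> 1"
  | S K \<epsilon> \<omega> where "U = end_nbhd G S K \<epsilon>" "finite S" "S \<subseteq> verts G"
    "K \<in> components_of_graph (delete_verts G S)" "\<omega> \<in> ends G" "lives_in \<omega> K" "0 < \<epsilon>" "\<epsilon> \<le> 1"
  using assms unfolding freudenthal_base_def by blast

lemma end_nbhd_cases [consumes 1, case_names vertex inner boundary at_end]:
  assumes "x \<in> end_nbhd G S K \<epsilon>"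
  obtains v where "x = vert_pt v" "v \<in> K"
  | u v t where "x = edge_pt u v t" "u \<in> K" "v \<in> K" "{u, v} \<in> edges G" "0 < t" "t < 1"
  | u v t where "x = edge_pt u v t" "u \<in> K" "v \<in> S" "{u, v} \<in> edges G" "0 < t" "t < \<epsilon>"
  | \<omega> where "x = End \<omega>" "\<omega> \<in> ends G" "lives_in \<omega> K"
  using assms unfolding end_nbhd_def by blast

lemma openin_freudenthal: "U \<in> freudenthal_base G \<Longrightarrow> openin (freudenthal G) U"
  unfolding freudenthal_eq by (rule topology_generated_by_Basis)

lemma topspace_freudenthal_cases:
  assumes "x \<in> topspace (freudenthal G)"
  obtains v where "v \<in> verts G" "x = vert_pt v"
  | u v t where "{u, v} \<in> edges G" "0 < t" "t < 1" "x = edge_pt u v t"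
  | \<omega> where "\<omega> \<in> ends G" "x = End \<omega>"
proof -
  obtain U where U: "U \<in> freudenthal_base G" "x \<in> U"
    using assms unfolding freudenthal_eq by auto
  from U(1) show thesis
  proof (cases rule: freudenthal_base_cases)
    case (segment u v a b)
    then obtain t where "x = edge_pt u v t" "a < t" "t < b"
      using U(2) unfolding open_segment_of_edge_def by auto
    then show ?thesis using that(2)[of u v t] segment by simp
  next
    case (vertex v d)
    then consider "x = vert_pt v" | w t where "x = edge_pt v w t" "{v, w} \<in> edges G" "0 < t" "t < d w"
      using U(2) unfolding vert_nbhd_def by blast
    then show ?thesis
    proof cases
      case 1 then show ?thesis using that(1) vertex by blast
    next
      case 2 then show ?thesis using that(2)[of v w t] vertex(4)[of w] by simp
    qed
  next
    case (at_end S K \<epsilon> \<omega>)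
    have "K \<subseteq> verts G" using component_subset[OF at_end(4)] by blast
    from U(2)[unfolded at_end(1)] show ?thesis
    proof (cases rule: end_nbhd_cases)
      case (vertex v) then show ?thesis using that(1) \<open>K \<subseteq> verts G\<close> by blast
    next
      case (inner u v t) then show ?thesis using that(2) by blast
    next
      case (boundary u v t) then show ?thesis using that(2)[of u v t] at_end(8) by simp
    next
      case (at_end \<omega>') then show ?thesis using that(3) by blast
    qed
  qed
qed

lemma end_nbhd_support:
  assumes "x \<in> end_nbhd G S K \<epsilon>" "\<epsilon> \<le> 1"
  shows "(\<exists>\<omega>. x = End \<omega>) \<or> support x \<inter> K \<noteq> {}"
  using assms(1) by (cases rule: end_nbhd_cases) (use assms(2) in \<open>auto simp: support_edge_pt\<close>)

lemma segment_in_base: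
  "{u, v} \<in> edges G \<Longrightarrow> 0 \<le> a \<Longrightarrow> a < b \<Longrightarrow> b \<le> 1 \<Longrightarrow> open_segment_of_edge u v a b \<in> freudenthal_base G"
  unfolding freudenthal_base_def by blast

lemma vert_nbhd_in_base:
  "v \<in> verts G \<Longrightarrow> 0 < c \<Longrightarrow> c \<le> 1 \<Longrightarrow> vert_nbhd G v (\<lambda>_. c) \<in> freudenthal_base G"
  unfolding freudenthal_base_def by blast

text \<open>Use the component of \<open>G - S\<close> in which the end lives: each point of the
  neighbourhood that is not an end has a nonzero coordinate there. Thus the vertices in
  \<open>S\<close> and the edges among them stay away from the end.\<close>

lemma end_nbhd_avoiding:
  assumes "simple_graph G" "\<omega> \<in> ends G" "finite S" "S \<subseteq> verts G"
  obtains U where "U \<in> freudenthal_base G" "End \<omega> \<in> U"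
    "\<And>x. x \<in> U \<Longrightarrow> support x \<subseteq> S \<Longrightarrow> \<exists>\<omega>'. x = End \<omega>'"
proof -
  obtain K where K: "K \<in> components_of_graph (delete_verts G S)" "lives_in \<omega> K"
    using end_lives_in_component[OF assms] by blast
  show thesis
  proof (rule that[of "end_nbhd G S K 1"])
    show "end_nbhd G S K 1 \<in> freudenthal_base G"
      unfolding freudenthal_base_def using K assms zero_less_one order_refl by blast
    show "End \<omega> \<in> end_nbhd G S K 1" using K(2) assms(2) unfolding end_nbhd_def by blast
    fix x assume "x \<in> end_nbhd G S K 1" "support x \<subseteq> S"
    then show "\<exists>\<omega>'. x = End \<omega>'"
      using end_nbhd_support[of x G S K 1] component_subset[OF K(1)] by auto
  qed
qed

section \<open>Hamilton circles and spanning double rays\<close>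

text \<open>Remove the end and read the rest of the circle as a line \<open>g\<close>. As there is
  one end only, all its points are vertices or lie inside edges. The parameters of vertices do not
  accumulate and are unbounded on both sides, and between two consecutive ones the line stays in a
  single edge.\<close>

lemma spanning_double_ray_if_hamilton_circle:
  assumes simple: "simple_graph G" and one_end: "ends G = {\<omega>}" and ham: "hamilton_circle G C"
  shows "\<exists>D. spanning_double_ray G D"
proof -
  let ?X = "freudenthal G"
  have circ: "circle_in ?X C" and vC: "vert_pt ` verts G \<subseteq> C" and eC: "End \<omega> \<in> C"
    using ham one_end unfolding hamilton_circle_def by auto
  obtain g :: "real \<Rightarrow> 'a point" where cont: "continuous_map euclideanreal ?X g" and inj: "inj g"
    and rng: "range g = C - {End \<omega>}"
    and lim: "\<And>U. openin ?X U \<Longrightarrow> End \<omega> \<in> U \<Longrightarrow> \<exists>B. \<forall>t. \<bar>t\<bar> > B \<longrightarrow> g t \<in> U"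
    using circle_minus_point[OF circ eC] by metis
  have near: "\<exists>d>0. \<forall>t'. dist t' t < d \<longrightarrow> g t' \<in> U" if "U \<in> freudenthal_base G" "g t \<in> U" for U t
  proof -
    have "openin euclideanreal {x \<in> topspace euclideanreal. g x \<in> U}"
      using openin_continuous_map_preimage[OF cont openin_freudenthal[OF that(1)]] .
    then have "open {x. g x \<in> U}" by simp
    then show ?thesis using that(2) unfolding open_dist by auto
  qed
  have gtop: "g t \<in> topspace ?X" for t
    using cont by (auto simp: continuous_map_def)
  have gEnd: "g t \<noteq> End \<omega>" for t using rng by auto
  define T where "T = {t. \<exists>v\<in>verts G. g t = vert_pt v}"
  have inner: "\<exists>u v s. {u, v} \<in> edges G \<and> 0 < s \<and> s < 1 \<and> g t = edge_pt u v s" if "t \<notin> T" for t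
    using gtop[of t]
  proof (cases rule: topspace_freudenthal_cases)
    case (1 v) then show ?thesis using that unfolding T_def by blast
  next
    case (2 u v s) then show ?thesis by blast
  next
    case (3 \<omega>') then show ?thesis using gEnd one_end by auto
  qed
  have seg: "\<exists>d>0. \<forall>t'. dist t' t < d \<longrightarrow> t' \<notin> T \<and> support (g t') = support (g t)"
    if tT: "t \<notin> T" for t
  proof -
    obtain u v s where e: "{u, v} \<in> edges G" "0 < s" "s < 1" "g t = edge_pt u v s" using inner[OF tT] by blast
    have ne: "u \<noteq> v" using simple_graph_edge[OF simple e(1)] by blast
    let ?U = "open_segment_of_edge u v 0 1"
    have "?U \<in> freudenthal_base G" "g t \<in> ?U"
      using segment_in_base[OF e(1), of 0 1] e unfolding open_segment_of_edge_def by auto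
    from near[OF this] obtain d where d: "d > 0" "\<And>t'. dist t' t < d \<Longrightarrow> g t' \<in> ?U" by blast
    have "t' \<notin> T \<and> support (g t') = support (g t)" if t': "dist t' t < d" for t'
    proof -
      obtain r where r: "g t' = edge_pt u v r" "0 < r" "r < 1"
        using d(2)[OF t'] unfolding open_segment_of_edge_def by auto
      then show ?thesis
        using edge_pt_neq_vert_pt[OF r(2,3) ne] e unfolding T_def by (auto simp: support_edge_pt)
    qed
    then show ?thesis using d(1) by blast
  qed
  \<comment> \<open>The open star of \<open>v\<close> contains no other vertex, and injectivity of
    \<open>g\<close> excludes a return to \<open>v\<close>. So \<open>T\<close> is discrete, and the
    edges used next to \<open>t\<close> contain \<open>v\<close>.\<close>
  have vtx: "\<exists>d>0. \<forall>t'. dist t' t < d \<and> t' \<noteq> t \<longrightarrow> t' \<notin> T \<and> v \<in> support (g t')"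
    if v: "v \<in> verts G" "g t = vert_pt v" for t v
  proof -
    let ?U = "vert_nbhd G v (\<lambda>_. 1)"
    have "?U \<in> freudenthal_base G" "g t \<in> ?U"
      using vert_nbhd_in_base[OF v(1), of 1] v(2) unfolding vert_nbhd_def by auto
    from near[OF this] obtain d where d: "d > 0" "\<And>t'. dist t' t < d \<Longrightarrow> g t' \<in> ?U" by blast
    have "t' \<notin> T \<and> v \<in> support (g t')" if t': "dist t' t < d" "t' \<noteq> t" for t'
    proof -
      have "g t' \<noteq> vert_pt v" using v(2) inj t'(2) by (metis injD)
      then obtain w r where r: "g t' = edge_pt v w r" "{v, w} \<in> edges G" "0 < r" "r < 1"
        using d(2)[OF t'(1)] unfolding vert_nbhd_def by auto
      then show ?thesis
        using edge_pt_neq_vert_pt[OF r(3,4) simple_graph_edge(1)[OF simple r(2)]]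
        unfolding T_def by (auto simp: support_edge_pt)
    qed
    then show ?thesis using d(1) by blast
  qed
  have not_limpt: "\<not> t islimpt T" for t
  proof -
    have "\<exists>d>0. \<forall>t'. dist t' t < d \<and> t' \<noteq> t \<longrightarrow> t' \<notin> T"
    proof (cases "t \<in> T")
      case True then show ?thesis using vtx unfolding T_def by blast
    next
      case False then show ?thesis using seg by blast
    qed
    then show ?thesis unfolding islimpt_approachable by blast
  qed
  have finT: "finite (T \<inter> {a..b})" for a b
    using finite_not_islimpt_in_compact[of "{a..b}" T] not_limpt by (simp add: Int_commute)
  have const: "support (g s) = support (g t)" if I: "connected I" "I \<inter> T = {}" "s \<in> I" "t \<in> I" for I s t
  proof (rule connected_local_const[OF I(1,3,4)])
    show "\<forall>a\<in>I. \<forall>\<^sub>F b in at a within I. support (g a) = support (g b)"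
    proof
      fix a assume "a \<in> I"
      then have "a \<notin> T" using I(2) by blast
      then obtain d where d: "d > 0" "\<And>t'. dist t' a < d \<Longrightarrow> support (g t') = support (g a)"
        using seg by metis
      show "\<forall>\<^sub>F b in at a within I. support (g a) = support (g b)"
        unfolding eventually_at using d(1) d(2)[symmetric] by blast
    qed
  qed
  \<comment> \<open>An unbounded interval without vertices would stay in one edge
    \<open>{u, v}\<close>; but \<open>g\<close> tends to the end, which has a neighbourhood free of
    points of that edge.\<close>
  have meets_T: "I \<inter> T \<noteq> {}" if I: "connected I" "\<And>B. \<exists>t\<in>I. \<bar>t\<bar> > B" for I
  proof
    assume disj: "I \<inter> T = {}"
    obtain t where t: "t \<in> I" using I(2) by blast
    then obtain u v s where e: "{u, v} \<in> edges G" "0 < s" "s < 1" "g t = edge_pt u v s"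
      using inner[of t] disj by blast
    have uv: "{u, v} \<subseteq> verts G" using simple_graph_edge[OF simple e(1)] by blast
    obtain U where U: "U \<in> freudenthal_base G" "End \<omega> \<in> U"
      "\<And>x. x \<in> U \<Longrightarrow> support x \<subseteq> {u, v} \<Longrightarrow> \<exists>\<omega>'. x = End \<omega>'"
      using end_nbhd_avoiding[OF simple _ _ uv, of \<omega>] one_end by auto
    obtain B where B: "\<And>t. \<bar>t\<bar> > B \<Longrightarrow> g t \<in> U"
      using lim[OF openin_freudenthal[OF U(1)] U(2)] by blast
    obtain t' where t': "t' \<in> I" "\<bar>t'\<bar> > B" using I(2) by blast
    have "support (g t') = {u, v}"
      using const[OF I(1) disj t'(1) t] e support_edge_pt by metis
    then obtain \<omega>' where "g t' = End \<omega>'" using U(3)[OF B[OF t'(2)]] by auto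
    moreover have "t' \<notin> T" using t' disj by blast
    ultimately show False using inner[of t'] by auto
  qed
  have up: "\<exists>t\<in>T. t > s" for s
  proof -
    have "\<exists>t\<in>{s<..}. \<bar>t\<bar> > B" for B by (intro bexI[of _ "max (s + 1) (\<bar>B\<bar> + 1)"]) auto
    then show ?thesis using meets_T[of "{s<..}"] by auto
  qed
  have down: "\<exists>t\<in>T. t < s" for s
  proof -
    have "\<exists>t\<in>{..<s}. \<bar>t\<bar> > B" for B by (intro bexI[of _ "min (s - 1) (- \<bar>B\<bar> - 1)"]) auto
    then show ?thesis using meets_T[of "{..<s}"] by auto
  qed
  obtain f :: "int \<Rightarrow> real" where f: "strict_mono f" "range f = T"
      "\<And>i. T \<inter> {f i<..<f (i + 1)} = {}"
    using enumerate_locally_finite[OF finT up down] by metis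
  have "\<forall>i. \<exists>v\<in>verts G. g (f i) = vert_pt v" using f(2) unfolding T_def by blast
  then obtain D where D: "\<And>i. D i \<in> verts G" "\<And>i. g (f i) = vert_pt (D i)" by metis
  have injf: "inj f" using f(1) strict_mono_imp_inj_on by blast
  have injD: "inj D"
  proof (rule injI)
    fix i j assume "D i = D j"
    then have "g (f i) = g (f j)" using D(2) by simp
    then show "i = j" using inj injf by (metis injD)
  qed
  have rngD: "range D = verts G"
  proof
    show "verts G \<subseteq> range D"
    proof
      fix v assume v: "v \<in> verts G"
      then have "vert_pt v \<in> range g" using vC rng by auto
      then obtain t where t: "g t = vert_pt v" by (metis imageE)
      then have "t \<in> range f" using f(2) v unfolding T_def by blast
      then obtain i where "t = f i" by blast
      then show "v \<in> range D" using t D(2)[of i] by auto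
    qed
  qed (use D(1) in blast)
  have "{D i, D (i + 1)} \<in> edges G" for i
  proof -
    let ?I = "{f i<..<f (i + 1)}"
    have lt: "f i < f (i + 1)" using f(1) by (simp add: strict_mono_less)
    have conI: "connected ?I" by simp
    have disj: "?I \<inter> T = {}" using f(3) by blast
    obtain t where t: "t \<in> ?I" using dense[OF lt] by auto
    obtain u v s where e: "{u, v} \<in> edges G" "0 < s" "s < 1" "g t = edge_pt u v s"
      using inner[of t] disj t by blast
    have supp: "support (g t') = {u, v}" if "t' \<in> ?I" for t'
      using const[OF conI disj that t] e support_edge_pt by metis
    \<comment> \<open>Just after \<open>f i\<close> the support equals \<open>{u, v}\<close> by
      constancy and contains \<open>D i\<close> by \<open>vtx\<close>.\<close>
    have "D i \<in> {u, v}"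
    proof -
      obtain d where d: "d > 0" "\<And>t'. dist t' (f i) < d \<Longrightarrow> t' \<noteq> f i \<Longrightarrow> D i \<in> support (g t')"
        using vtx[OF D(1) D(2), of i] by blast
      obtain t' where "f i < t'" "t' < min (f (i + 1)) (f i + d)"
        using dense[of "f i" "min (f (i + 1)) (f i + d)"] lt d(1) by auto
      then show ?thesis using supp[of t'] d(2)[of t'] by (auto simp: dist_real_def)
    qed
    moreover have "D (i + 1) \<in> {u, v}"
    proof -
      obtain d where d: "d > 0" "\<And>t'. dist t' (f (i + 1)) < d \<Longrightarrow> t' \<noteq> f (i + 1) \<Longrightarrow> D (i + 1) \<in> support (g t')"
        using vtx[OF D(1) D(2), of "i + 1"] by blast
      obtain t' where "t' < f (i + 1)" "max (f i) (f (i + 1) - d) < t'"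
        using dense[of "max (f i) (f (i + 1) - d)" "f (i + 1)"] lt d(1) by auto
      then show ?thesis using supp[of t'] d(2)[of t'] by (auto simp: dist_real_def)
    qed
    moreover have "D i \<noteq> D (i + 1)" using injD by (simp add: inj_eq)
    ultimately have "{D i, D (i + 1)} = {u, v}" by auto
    then show ?thesis using e(1) by simp
  qed
  then show ?thesis using injD rngD unfolding spanning_double_ray_def by blast
qed

section \<open>From a spanning double ray to a Hamilton circle\<close>

lemma base_nbhd_inner:
  assumes simple: "simple_graph G" and U: "U \<in> freudenthal_base G" "edge_pt x y s \<in> U"
    and e: "{x, y} \<in> edges G" "0 < s" "s < 1"
  shows "\<exists>d>0. \<forall>s'. \<bar>s' - s\<bar> < d \<longrightarrow> edge_pt x y s' \<in> U"
proof -
  have ne: "x \<noteq> y" using simple_graph_edge[OF simple e(1)] by blast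
  \<comment> \<open>A generating set presents the point on an edge \<open>u v\<close> whose
    direction may be opposite to \<open>x y\<close>; both directions are settled here once for all
    kinds of sets.\<close>
  have seg: ?thesis if uv: "edge_pt x y s = edge_pt u v r" "0 \<le> a" "a < r" "r < b" "b \<le> 1"
      and sub: "\<And>r'. a < r' \<Longrightarrow> r' < b \<Longrightarrow> edge_pt u v r' \<in> U" for u v r a b
  proof -
    consider "x = u" "y = v" "s = r" | "x = v" "y = u" "s = 1 - r"
      using edge_pt_eq_edge_pt[OF uv(1) ne e(2,3)] uv(2-5) by auto
    then show ?thesis
    proof cases
      case 1
      have "edge_pt x y s' \<in> U" if "\<bar>s' - s\<bar> < min (r - a) (b - r)" for s'
        using sub[of s'] that 1 by auto
      then show ?thesis using uv(3,4) by (intro exI[of _ "min (r - a) (b - r)"]) auto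
    next
      case 2
      have "edge_pt x y s' \<in> U" if "\<bar>s' - s\<bar> < min (r - a) (b - r)" for s'
        using sub[of "1 - s'"] that 2 edge_pt_commute[of x y s'] by auto
      then show ?thesis using uv(3,4) by (intro exI[of _ "min (r - a) (b - r)"]) auto
    qed
  qed
  have nv: "edge_pt x y s \<noteq> vert_pt v" for v using edge_pt_neq_vert_pt[OF e(2,3) ne] .
  from U(1) show ?thesis
  proof (cases rule: freudenthal_base_cases)
    case (segment u v a b)
    then obtain r where r: "edge_pt x y s = edge_pt u v r" "a < r" "r < b"
      using U(2) unfolding open_segment_of_edge_def by auto
    show ?thesis
      by (rule seg[OF r(1) segment(3) r(2,3) segment(5)]) (auto simp: segment(1) open_segment_of_edge_def)
  next
    case (vertex v d)
    then obtain w r where r: "edge_pt x y s = edge_pt v w r" "0 < r" "r < d w" "{v, w} \<in> edges G"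
      using U(2) nv unfolding vert_nbhd_def by auto
    show ?thesis
      by (rule seg[OF r(1) order_refl r(2,3) vertex(4)]) (use r(4) in \<open>auto simp: vertex(1) vert_nbhd_def\<close>)
  next
    case (at_end S K \<epsilon> \<omega>)
    have UI: "edge_pt u v r' \<in> U"
      if "u \<in> K" "{u, v} \<in> edges G" "v \<in> K \<and> 0 < r' \<and> r' < 1 \<or> v \<in> S \<and> 0 < r' \<and> r' < \<epsilon>" for u v r'
      using that unfolding at_end(1) end_nbhd_def by blast
    from U(2)[unfolded at_end(1)] show ?thesis
    proof (cases rule: end_nbhd_cases)
      case (vertex v)
      then show ?thesis using nv by blast
    next
      case (inner u v r)
      then show ?thesis by (intro seg[OF inner(1) order_refl inner(5,6) order_refl] UI) auto
    next
      case (boundary u v r)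
      then show ?thesis by (intro seg[OF boundary(1) order_refl boundary(5,6) at_end(8)] UI) auto
    next
      case (at_end \<omega>')
      then show ?thesis by simp
    qed
  qed
qed

lemma base_nbhd_vertex:
  assumes simple: "simple_graph G" and U: "U \<in> freudenthal_base G" "vert_pt x \<in> U"
    and e: "{x, y} \<in> edges G"
  shows "\<exists>d>0. \<forall>s. 0 \<le> s \<and> s < d \<longrightarrow> edge_pt x y s \<in> U"
proof -
  have pos: ?thesis if "d > 0" "\<And>s. 0 < s \<Longrightarrow> s < d \<Longrightarrow> edge_pt x y s \<in> U" for d
  proof -
    have "edge_pt x y s \<in> U" if "0 \<le> s" "s < d" for s
      using that U(2) \<open>\<And>s. 0 < s \<Longrightarrow> s < d \<Longrightarrow> edge_pt x y s \<in> U\<close> by (cases "s = 0") auto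
    then show ?thesis using that(1) by blast
  qed
  have nv: "vert_pt x \<noteq> edge_pt u v r" if "{u, v} \<in> edges G" "0 < r" "r < 1" for u v r
    using edge_pt_neq_vert_pt[OF that(2,3)] simple_graph_edge[OF simple that(1)] by metis
  from U(1) show ?thesis
  proof (cases rule: freudenthal_base_cases)
    case (segment u v a b)
    then obtain r where "vert_pt x = edge_pt u v r" "a < r" "r < b"
      using U(2) unfolding open_segment_of_edge_def by auto
    then show ?thesis using nv[OF segment(2), of r] segment(3,5) by simp
  next
    case (vertex v d)
    have "vert_pt x \<noteq> edge_pt v w r" if "{v, w} \<in> edges G" "0 < r" "r < d w" for w r
      using nv[OF that(1,2)] that(3) vertex(4)[of w] by simp
    then have "x = v" using U(2) unfolding vertex(1) vert_nbhd_def by auto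
    then show ?thesis
      by (intro pos[OF vertex(3)[of y]]) (use e in \<open>auto simp: vertex(1) vert_nbhd_def\<close>)
  next
    case (at_end S K \<epsilon> \<omega>)
    from U(2)[unfolded at_end(1)] have xK: "x \<in> K"
    proof (cases rule: end_nbhd_cases)
      case (inner u v r)
      then show ?thesis using nv[of u v r] by simp
    next
      case (boundary u v r)
      then show ?thesis using nv[of u v r] at_end(8) by simp
    qed simp_all
    show ?thesis
    proof (cases "y \<in> S")
      case True
      show ?thesis
        by (rule pos[OF at_end(7)]) (use True xK e in \<open>unfold at_end(1) end_nbhd_def, blast\<close>)
    next
      case False
      then have "y \<in> K" using component_closed[OF simple at_end(4) xK e] by blast
      then show ?thesis
        by (intro pos[OF zero_less_one]) (use xK e in \<open>unfold at_end(1) end_nbhd_def, blast\<close>)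
    qed
  qed
qed

definition line_pt :: "(int \<Rightarrow> 'a) \<Rightarrow> real \<Rightarrow> 'a point" where
  "line_pt D t = edge_pt (D \<lfloor>t\<rfloor>) (D (\<lfloor>t\<rfloor> + 1)) (frac t)"

lemma line_pt_of_int [simp]: "line_pt D (of_int i) = vert_pt (D i)"
  by (simp add: line_pt_def)

lemma line_pt_right:
  assumes "0 \<le> s" "s \<le> 1"
  shows "line_pt D (of_int i + s) = edge_pt (D i) (D (i + 1)) s"
proof (cases "s = 1")
  \<comment> \<open>The floor has already moved to \<open>i + 1\<close>; both sides are the vertex
    \<open>D (i + 1)\<close>.\<close>
  case True
  then show ?thesis using line_pt_of_int[of D "i + 1"] by simp
next
  case False
  then have "\<lfloor>of_int i + s\<rfloor> = i" using assms by (simp add: floor_eq_iff)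
  then show ?thesis by (simp add: line_pt_def frac_def)
qed

lemma line_pt_left:
  assumes "0 \<le> s" "s \<le> 1"
  shows "line_pt D (of_int i - s) = edge_pt (D i) (D (i - 1)) s"
  using line_pt_right[of "1 - s" D "i - 1"] assms edge_pt_commute[of "D i" "D (i - 1)" s] by simp

lemma line_pt_cases:
  obtains i where "t = of_int i" "line_pt D t = vert_pt (D i)"
  | i s where "t = of_int i + s" "0 < s" "s < 1" "line_pt D t = edge_pt (D i) (D (i + 1)) s"
proof (cases "frac t = 0")
  case True
  then have "t = of_int \<lfloor>t\<rfloor>" by (simp add: frac_def)
  then show ?thesis using that(1)[of "\<lfloor>t\<rfloor>"] line_pt_of_int by metis
next
  case False
  then have "0 < frac t" by (simp add: less_le)
  then show ?thesis using that(2)[of "\<lfloor>t\<rfloor>" "frac t"]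
    by (simp add: line_pt_def frac_lt_1) (simp add: frac_def)
qed

lemma inj_line_pt:
  assumes D: "inj D"
  shows "inj (line_pt D)"
proof (rule injI)
  fix t t' assume eq: "line_pt D t = line_pt D t'"
  have ne: "D i \<noteq> D (i + 1)" for i using D by (simp add: inj_eq)
  show "t = t'"
  proof (cases t D rule: line_pt_cases)
    case t: (1 i)
    show ?thesis
    proof (cases t' D rule: line_pt_cases)
      case (1 j)
      then show ?thesis using eq t D by (simp add: inj_eq)
    next
      case (2 j r)
      then show ?thesis using eq t edge_pt_neq_vert_pt[OF 2(2,3) ne, of j "D i"] by simp
    qed
  next
    case t: (2 i s)
    show ?thesis
    proof (cases t' D rule: line_pt_cases)
      case (1 j)
      then show ?thesis using eq t edge_pt_neq_vert_pt[OF t(2,3) ne, of i "D j"] by simp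
    next
      case t': (2 j r)
      have "edge_pt (D i) (D (i + 1)) s = edge_pt (D j) (D (j + 1)) r" using eq t t' by simp
      from edge_pt_eq_edge_pt[OF this ne t(2,3) t'(2,3)] D t t' show ?thesis
        by (auto simp: inj_eq)
    qed
  qed
qed

locale double_ray_in_one_ended =
  fixes G :: "'a ugraph" and \<omega> :: "(nat \<Rightarrow> 'a) set" and D :: "int \<Rightarrow> 'a"
  assumes simple: "simple_graph G" and one_end: "ends G = {\<omega>}" and sdr: "spanning_double_ray G D"
begin

lemma D_inj: "inj D" and D_range: "range D = verts G" and D_edge: "{D i, D (i + 1)} \<in> edges G"
  using sdr unfolding spanning_double_ray_def by auto

lemma D_edge': "{D i, D (i - 1)} \<in> edges G"
  using D_edge[of "i - 1"] by (simp add: insert_commute)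

text \<open>Both halves of \<open>D\<close> are rays, and with a single end both belong to it. This
  is why the two directions of the line converge to the same point.\<close>

lemma tails_in:
  assumes "lives_in \<omega> K"
  obtains N :: nat where "\<And>i. \<bar>i\<bar> \<ge> int N \<Longrightarrow> D i \<in> K"
proof -
  have "ray G (\<lambda>n. D (int n))"
    using D_edge[of "int n" for n] unfolding ray_def inj_def
    by (simp add: inj_eq[OF D_inj] add.commute)
  moreover have "{D (- int n), D (- int (Suc n))} \<in> edges G" for n
  proof -
    have "- int (Suc n) = - int n - 1" by simp
    then show ?thesis using D_edge'[of "- int n"] by metis
  qed
  then have "ray G (\<lambda>n. D (- int n))"
    unfolding ray_def inj_def inj_eq[OF D_inj] by simp
  ultimately have "has_tail_in (\<lambda>n. D (int n)) K" "has_tail_in (\<lambda>n. D (- int n)) K"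
    using assms ray_in_unique_end[OF simple one_end] unfolding lives_in_def by auto
  then obtain a b where a: "\<And>n. n \<ge> a \<Longrightarrow> D (int n) \<in> K" and b: "\<And>n. n \<ge> b \<Longrightarrow> D (- int n) \<in> K"
    unfolding has_tail_in_def by auto
  show ?thesis
  proof (rule that[of "max a b"])
    fix i :: int assume i: "\<bar>i\<bar> \<ge> int (max a b)"
    show "D i \<in> K"
      using a[of "nat i"] b[of "nat (- i)"] i by (cases "i \<ge> 0") auto
  qed
qed

lemma open_line_pt:
  assumes U: "U \<in> freudenthal_base G"
  shows "open (line_pt D -` U)"
  unfolding open_dist
proof
  fix t assume "t \<in> line_pt D -` U"
  then have tU: "line_pt D t \<in> U" by simp
  show "\<exists>e>0. \<forall>y. dist y t < e \<longrightarrow> y \<in> line_pt D -` U"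
  proof (cases t D rule: line_pt_cases)
    case (1 i)
    have v: "vert_pt (D i) \<in> U" using 1 tU by simp
    obtain d where d: "d > 0" "\<And>s. 0 \<le> s \<Longrightarrow> s < d \<Longrightarrow> edge_pt (D i) (D (i + 1)) s \<in> U"
      using base_nbhd_vertex[OF simple U v D_edge] by auto
    obtain d' where d': "d' > 0" "\<And>s. 0 \<le> s \<Longrightarrow> s < d' \<Longrightarrow> edge_pt (D i) (D (i - 1)) s \<in> U"
      using base_nbhd_vertex[OF simple U v D_edge'] by auto
    have "line_pt D y \<in> U" if y: "dist y t < Min {d, d', 1}" for y
    proof (cases "y \<ge> t")
      case True
      then show ?thesis using line_pt_right[of "y - t" D i] d(2)[of "y - t"] y 1
        by (auto simp: dist_real_def)
    next
      case False
      then show ?thesis using line_pt_left[of "t - y" D i] d'(2)[of "t - y"] y 1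
        by (auto simp: dist_real_def)
    qed
    then show ?thesis using d(1) d'(1) by (intro exI[of _ "Min {d, d', 1}"]) auto
  next
    case (2 i s)
    obtain d where d: "d > 0" "\<And>s'. \<bar>s' - s\<bar> < d \<Longrightarrow> edge_pt (D i) (D (i + 1)) s' \<in> U"
      using base_nbhd_inner[OF simple U _ D_edge 2(2,3)] 2(4) tU by auto
    have "line_pt D y \<in> U" if y: "dist y t < Min {d, s, 1 - s}" for y
    proof -
      define s' where "s' = y - of_int i"
      have "\<bar>s' - s\<bar> < d" "0 \<le> s'" "s' \<le> 1" using y 2 unfolding s'_def by (auto simp: dist_real_def)
      then have "line_pt D (of_int i + s') \<in> U" using line_pt_right d(2) by metis
      then show ?thesis unfolding s'_def by simp
    qed
    then show ?thesis using d(1) 2(2,3) by (intro exI[of _ "Min {d, s, 1 - s}"]) auto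
  qed
qed

lemma line_pt_tends_to_end:
  assumes "U \<in> freudenthal_base G" "End \<omega> \<in> U"
  shows "\<exists>B. \<forall>t. \<bar>t\<bar> > B \<longrightarrow> line_pt D t \<in> U"
  using assms(1)
proof (cases rule: freudenthal_base_cases)
  case (segment u v a b)
  then show ?thesis using assms(2) unfolding open_segment_of_edge_def by auto
next
  case (vertex v d)
  then show ?thesis using assms(2) unfolding vert_nbhd_def by auto
next
  case (at_end S K \<epsilon> \<omega>')
  have "lives_in \<omega> K" using assms(2) unfolding at_end(1) end_nbhd_def by auto
  then obtain N where N: "\<And>i. \<bar>i\<bar> \<ge> int N \<Longrightarrow> D i \<in> K" using tails_in by blast
  \<comment> \<open>The margin 2 keeps both integers \<open>i\<close> and \<open>i + 1\<close>
    around \<open>t\<close> at absolute value at least \<open>N\<close>, so the whole segment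
    between them lies in the neighbourhood.\<close>
  show ?thesis
  proof (intro exI[of _ "real N + 2"] allI impI)
    fix t :: real assume t: "\<bar>t\<bar> > real N + 2"
    show "line_pt D t \<in> U"
    proof (cases t D rule: line_pt_cases)
      case (1 i)
      have "\<bar>i\<bar> \<ge> int N" using t 1(1) by linarith
      then show ?thesis using N 1(2) unfolding at_end(1) end_nbhd_def by auto
    next
      case (2 i s)
      have "\<bar>i\<bar> \<ge> int N" "\<bar>i + 1\<bar> \<ge> int N" using t 2(1-3) by linarith+
      then have "D i \<in> K" "D (i + 1) \<in> K" using N by auto
      then show ?thesis using D_edge[of i] 2(2-4) unfolding at_end(1) end_nbhd_def by blast
    qed
  qed
qed

text \<open>A star around a vertex or a segment of an edge will do. The star also contains pieces of
  a chord, but only its trace on the line has to be short.\<close>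

lemma line_pt_isolating_nbhd:
  assumes "e > 0"
  obtains U where "U \<in> freudenthal_base G" "line_pt D t \<in> U" "\<And>t'. line_pt D t' \<in> U \<Longrightarrow> \<bar>t' - t\<bar> < e"
proof (cases t D rule: line_pt_cases)
  case (1 i)
  define c where "c = min e 1"
  show ?thesis
  proof (rule that[of "vert_nbhd G (D i) (\<lambda>_. c)"])
    show "vert_nbhd G (D i) (\<lambda>_. c) \<in> freudenthal_base G"
      using assms D_range unfolding c_def by (intro vert_nbhd_in_base) auto
    show "line_pt D t \<in> vert_nbhd G (D i) (\<lambda>_. c)" using 1 unfolding vert_nbhd_def by simp
    fix t' assume "line_pt D t' \<in> vert_nbhd G (D i) (\<lambda>_. c)"
    then consider "line_pt D t' = line_pt D t"
      | w r where "line_pt D t' = edge_pt (D i) w r" "{D i, w} \<in> edges G" "0 < r" "r < c"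
      unfolding vert_nbhd_def using 1 by auto
    then show "\<bar>t' - t\<bar> < e"
    proof cases
      case c1: 1
      then show ?thesis using inj_line_pt[OF D_inj] assms by (simp add: inj_eq)
    next
      case c2: (2 w r)
      have r1: "r < 1" "r < e" using c2 unfolding c_def by auto
      have ne: "D i \<noteq> w" using simple_graph_edge[OF simple c2(2)] by blast
      show ?thesis
      proof (cases t' D rule: line_pt_cases)
        case (1 j)
        then show ?thesis using c2 edge_pt_neq_vert_pt[OF c2(3) r1(1) ne, of "D j"] by simp
      next
        case j: (2 j s)
        have "edge_pt (D i) w r = edge_pt (D j) (D (j + 1)) s" using c2 j by simp
        from edge_pt_eq_edge_pt[OF this ne c2(3) r1(1) j(2,3)] D_inj
        show ?thesis using j(1) 1(1) r1(2) c2(3) by (auto simp: inj_eq)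
      qed
    qed
  qed
next
  case (2 i s)
  define a b where "a = max 0 (s - e)" and "b = min 1 (s + e)"
  have ab: "0 \<le> a" "a < s" "s < b" "b \<le> 1" using 2 assms unfolding a_def b_def by auto
  show ?thesis
  proof (rule that[of "open_segment_of_edge (D i) (D (i + 1)) a b"])
    show "open_segment_of_edge (D i) (D (i + 1)) a b \<in> freudenthal_base G"
      using ab by (intro segment_in_base D_edge) auto
    show "line_pt D t \<in> open_segment_of_edge (D i) (D (i + 1)) a b"
      using 2 ab unfolding open_segment_of_edge_def by auto
    fix t' assume "line_pt D t' \<in> open_segment_of_edge (D i) (D (i + 1)) a b"
    then obtain r where r: "line_pt D t' = edge_pt (D i) (D (i + 1)) r" "a < r" "r < b"
      unfolding open_segment_of_edge_def by auto
    then have "line_pt D t' = line_pt D (of_int i + r)" using line_pt_right[of r D i] ab by simp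
    then have "t' = of_int i + r" using inj_line_pt[OF D_inj] by (simp add: inj_eq)
    then show "\<bar>t' - t\<bar> < e" using 2(1) r(2,3) unfolding a_def b_def by auto
  qed
qed

lemma end_isolating_nbhd:
  obtains U where "U \<in> freudenthal_base G" "End \<omega> \<in> U" "\<And>t'. line_pt D t' \<in> U \<Longrightarrow> \<bar>t' - t\<bar> \<ge> 1"
proof -
  \<comment> \<open>Any segment of the line that comes within distance less than 1 of
    \<open>t\<close> has both its vertices among these four.\<close>
  define S where "S = D ` {\<lfloor>t\<rfloor> - 1..\<lfloor>t\<rfloor> + 2}"
  have S: "finite S" "S \<subseteq> verts G" using D_range unfolding S_def by auto
  obtain U where U: "U \<in> freudenthal_base G" "End \<omega> \<in> U"
      "\<And>x. x \<in> U \<Longrightarrow> support x \<subseteq> S \<Longrightarrow> \<exists>\<omega>'. x = End \<omega>'"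
    using end_nbhd_avoiding[OF simple _ S, of \<omega>] one_end by auto
  have "\<bar>t' - t\<bar> \<ge> 1" if t': "line_pt D t' \<in> U" for t'
  proof (rule ccontr)
    assume lt: "\<not> \<bar>t' - t\<bar> \<ge> 1"
    have "support (line_pt D t') \<subseteq> S"
    proof (cases t' D rule: line_pt_cases)
      case (1 i)
      then have "i \<in> {\<lfloor>t\<rfloor> - 1..\<lfloor>t\<rfloor> + 2}" using lt by (simp, linarith)
      then show ?thesis using 1 unfolding S_def by simp
    next
      case (2 i s)
      then have "i \<in> {\<lfloor>t\<rfloor> - 1..\<lfloor>t\<rfloor> + 2}" "i + 1 \<in> {\<lfloor>t\<rfloor> - 1..\<lfloor>t\<rfloor> + 2}"
        using lt by (simp, linarith)+
      then have "{D i, D (i + 1)} \<subseteq> S" unfolding S_def by blast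
      then show ?thesis using 2 by (simp add: support_edge_pt)
    qed
    then have "\<exists>\<omega>'. line_pt D t' = End \<omega>'" using U(3) t' by blast
    then show False by (simp add: line_pt_def)
  qed
  then show ?thesis using that U by blast
qed

text \<open>Only points of the circle must be separated, by sets that are disjoint on the circle; so
  the isolating neighbourhoods suffice, whatever they share outside it.\<close>

lemma Hausdorff_line_plus_end:
  "Hausdorff_space (subtopology (freudenthal G) (insert (End \<omega>) (range (line_pt D))))"
proof -
  let ?C = "insert (End \<omega>) (range (line_pt D))"
  \<comment> \<open>A generating set around the end contains points of the line arbitrarily far out,
    so its trace on the line is not bounded.\<close>
  have not_End: "End \<omega> \<notin> U" if U: "\<And>t'. line_pt D t' \<in> U \<Longrightarrow> \<bar>t' - t\<bar> < e" "U \<in> freudenthal_base G" for U t e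
  proof
    assume "End \<omega> \<in> U"
    then obtain B where B: "\<And>t. \<bar>t\<bar> > B \<Longrightarrow> line_pt D t \<in> U" using line_pt_tends_to_end U(2) by blast
    define t' where "t' = max (\<bar>B\<bar> + 1) (t + \<bar>e\<bar> + 1)"
    have "\<bar>t'\<bar> > B" "\<not> \<bar>t' - t\<bar> < e" unfolding t'_def by linarith+
    then show False using B U(1) by blast
  qed
  have sep: "\<exists>U V. openin (subtopology (freudenthal G) ?C) U \<and> openin (subtopology (freudenthal G) ?C) V \<and>
      x \<in> U \<and> y \<in> V \<and> disjnt U V"
    if "U \<in> freudenthal_base G" "V \<in> freudenthal_base G" "x \<in> U" "y \<in> V" "x \<in> ?C" "y \<in> ?C"
      "U \<inter> V \<inter> ?C = {}" for x y U V
  proof -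
    have "disjnt (U \<inter> ?C) (V \<inter> ?C)" using that(7) unfolding disjnt_def by blast
    moreover have "openin (subtopology (freudenthal G) ?C) (U \<inter> ?C)"
      "openin (subtopology (freudenthal G) ?C) (V \<inter> ?C)"
      using that(1,2) openin_freudenthal openin_subtopology_Int by blast+
    ultimately show ?thesis using that(3-6) by blast
  qed
  have line_end: "\<exists>U V. U \<in> freudenthal_base G \<and> V \<in> freudenthal_base G \<and>
      line_pt D t \<in> U \<and> End \<omega> \<in> V \<and> U \<inter> V \<inter> ?C = {}" for t
  proof -
    obtain U where U: "U \<in> freudenthal_base G" "line_pt D t \<in> U" "\<And>t'. line_pt D t' \<in> U \<Longrightarrow> \<bar>t' - t\<bar> < 1"
      using line_pt_isolating_nbhd[OF zero_less_one] by blast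
    obtain V where V: "V \<in> freudenthal_base G" "End \<omega> \<in> V" "\<And>t'. line_pt D t' \<in> V \<Longrightarrow> \<bar>t' - t\<bar> \<ge> 1"
      using end_isolating_nbhd by blast
    have "U \<inter> V \<inter> ?C = {}" using U(3) V(3) not_End[OF U(3) U(1)] by fastforce
    then show ?thesis using U V by blast
  qed
  show ?thesis
    unfolding Hausdorff_space_def
  proof (intro allI impI)
    fix x y assume "x \<in> topspace (subtopology (freudenthal G) ?C) \<and>
      y \<in> topspace (subtopology (freudenthal G) ?C) \<and> x \<noteq> y"
    then have xy: "x \<in> ?C" "y \<in> ?C" "x \<noteq> y" by auto
    then consider s t where "x = line_pt D s" "y = line_pt D t" "s \<noteq> t"
      | t where "x = line_pt D t" "y = End \<omega>" | t where "x = End \<omega>" "y = line_pt D t" by blast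
    then show "\<exists>U V. openin (subtopology (freudenthal G) ?C) U \<and> openin (subtopology (freudenthal G) ?C) V \<and>
      x \<in> U \<and> y \<in> V \<and> disjnt U V"
    proof cases
      case (1 s t)
      define e where "e = \<bar>s - t\<bar> / 2"
      have e: "e > 0" using 1 unfolding e_def by simp
      obtain U where U: "U \<in> freudenthal_base G" "line_pt D s \<in> U" "\<And>t'. line_pt D t' \<in> U \<Longrightarrow> \<bar>t' - s\<bar> < e"
        using line_pt_isolating_nbhd[OF e] by blast
      obtain V where V: "V \<in> freudenthal_base G" "line_pt D t \<in> V" "\<And>t'. line_pt D t' \<in> V \<Longrightarrow> \<bar>t' - t\<bar> < e"
        using line_pt_isolating_nbhd[OF e] by blast
      have "False" if "line_pt D r \<in> U" "line_pt D r \<in> V" for r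
        using U(3)[OF that(1)] V(3)[OF that(2)] unfolding e_def by (auto simp: abs_if split: if_splits)
      then have disj: "U \<inter> V \<inter> ?C = {}" using not_End[OF U(3) U(1)] by auto
      show ?thesis by (rule sep[OF U(1) V(1) _ _ xy(1,2) disj]) (simp_all add: 1 U(2) V(2))
    next
      case (2 t)
      obtain U V where UV: "U \<in> freudenthal_base G" "V \<in> freudenthal_base G"
        "line_pt D t \<in> U" "End \<omega> \<in> V" "U \<inter> V \<inter> ?C = {}" using line_end[of t] by (elim exE conjE)
      show ?thesis by (rule sep[OF UV(1,2) _ _ xy(1,2) UV(5)]) (simp_all add: 2 UV(3,4))
    next
      case (3 t)
      obtain U V where UV: "U \<in> freudenthal_base G" "V \<in> freudenthal_base G"
        "line_pt D t \<in> U" "End \<omega> \<in> V" "U \<inter> V \<inter> ?C = {}" using line_end[of t] by (elim exE conjE)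
      then have disj: "V \<inter> U \<inter> ?C = {}" by blast
      show ?thesis by (rule sep[OF UV(2,1) _ _ xy(1,2) disj]) (simp_all add: 3 UV(3,4))
    qed
  qed
qed

lemma hamilton_circle_line: "hamilton_circle G (insert (End \<omega>) (range (line_pt D)))"
proof -
  have "line_pt D t \<in> \<Union>(freudenthal_base G)" for t
    using line_pt_isolating_nbhd[OF zero_less_one, of t] by blast
  then have line_top: "range (line_pt D) \<subseteq> \<Union>(freudenthal_base G)" by blast
  have end_top: "End \<omega> \<in> \<Union>(freudenthal_base G)" using end_isolating_nbhd[of 0] by blast
  have end_line: "End \<omega> \<notin> range (line_pt D)" by (auto simp: line_pt_def)
  have "circle_in (freudenthal G) (insert (End \<omega>) (range (line_pt D)))"
    unfolding freudenthal_eq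
    by (rule circle_in_line_plus_point[OF open_line_pt line_top end_top end_line inj_line_pt[OF D_inj]
          line_pt_tends_to_end Hausdorff_line_plus_end[unfolded freudenthal_eq]])
  moreover have "vert_pt ` verts G \<subseteq> range (line_pt D)"
  proof
    fix x assume "x \<in> vert_pt ` verts G"
    then obtain i where "x = vert_pt (D i)" unfolding D_range[symmetric] by blast
    then show "x \<in> range (line_pt D)" using line_pt_of_int[of D i] by (metis rangeI)
  qed
  ultimately show ?thesis unfolding hamilton_circle_def one_end by auto
qed

text \<open>The midpoint of an edge determines the edge through its support, so this one point
  already keeps chords out of the circle.\<close>

lemma closed_edge_subset_line_iff:
  assumes "e \<in> edges G"
  shows "closed_edge e \<subseteq> insert (End \<omega>) (range (line_pt D)) \<longleftrightarrow> e \<in> range (\<lambda>i. {D i, D (i + 1)})"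
proof
  assume sub: "closed_edge e \<subseteq> insert (End \<omega>) (range (line_pt D))"
  have "card e = 2" using assms simple unfolding simple_graph_def by blast
  then obtain u v where uv: "e = {u, v}" "u \<noteq> v" by (meson card_2_iff)
  have "edge_pt u v (1/2) \<in> closed_edge e" unfolding closed_edge_def using uv(1) by force
  then have "edge_pt u v (1/2) \<in> range (line_pt D)" using sub by auto
  then obtain t where t: "line_pt D t = edge_pt u v (1/2)" by (metis imageE)
  have supp: "support (edge_pt u v (1/2)) = {u, v}" by (rule support_edge_pt) auto
  show "e \<in> range (\<lambda>i. {D i, D (i + 1)})"
  proof (cases t D rule: line_pt_cases)
    case (1 i)
    then show ?thesis using t edge_pt_neq_vert_pt[of "1/2" u v "D i"] uv by simp
  next
    case (2 i s)
    then have "e = {D i, D (i + 1)}" using supp support_edge_pt[OF 2(2,3)] t uv(1) by metis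
    then show ?thesis by blast
  qed
next
  assume "e \<in> range (\<lambda>i. {D i, D (i + 1)})"
  then obtain i where i: "e = {D i, D (i + 1)}" by blast
  show "closed_edge e \<subseteq> insert (End \<omega>) (range (line_pt D))"
  proof
    fix x assume "x \<in> closed_edge e"
    then obtain u v t where x: "x = edge_pt u v t" "e = {u, v}" "0 \<le> t" "t \<le> 1"
      unfolding closed_edge_def by blast
    then consider "u = D i" "v = D (i + 1)" | "u = D (i + 1)" "v = D i"
      using i by (metis doubleton_eq_iff)
    then have "x = line_pt D (of_int i + t) \<or> x = line_pt D (of_int (i + 1) - t)"
      using line_pt_right[OF x(3,4), of D i] line_pt_left[OF x(3,4), of D "i + 1"] x(1) by cases auto
    then show "x \<in> insert (End \<omega>) (range (line_pt D))" by blast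
  qed
qed

theorem hamilton_cycle_double_ray:
  "hamilton_cycle G \<lparr>verts = verts G, edges = range (\<lambda>i. {D i, D (i + 1)})\<rparr>"
proof -
  let ?C = "insert (End \<omega>) (range (line_pt D))"
  have "{v \<in> verts G. vert_pt v \<in> ?C} = verts G"
    using hamilton_circle_line unfolding hamilton_circle_def by blast
  moreover have "{e \<in> edges G. closed_edge e \<subseteq> ?C} = range (\<lambda>i. {D i, D (i + 1)})"
    using closed_edge_subset_line_iff D_edge by blast
  ultimately show ?thesis
    unfolding hamilton_cycle_def using hamilton_circle_line by (intro exI[of _ ?C]) simp
qed

end

section \<open>A second Hamilton cycle\<close>

text \<open>Two of the three neighbours of \<open>D i\<close> precede and follow it on the line;
  \<open>m i\<close> is the index of the third. It is an involution because adjacency is symmetric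
  and a chord is never a line edge.\<close>

lemma chord_matching_of_double_ray:
  assumes cubic: "cubic_graph G" and sdr: "spanning_double_ray G D"
  obtains m where "chord_matching m" "\<And>i j. {D i, D j} \<in> edges G \<longleftrightarrow> j \<in> {i - 1, i + 1, m i}"
proof -
  have simple: "simple_graph G" and deg: "\<And>v. v \<in> verts G \<Longrightarrow> vert_degree G v = 3"
    using cubic unfolding cubic_graph_def by auto
  have inj: "inj D" and rng: "range D = verts G" and edge: "\<And>i. {D i, D (i + 1)} \<in> edges G"
    using sdr unfolding spanning_double_ray_def by auto
  define N where "N = (\<lambda>i. {j. {D i, D j} \<in> edges G})"
  have N_sym: "j \<in> N i \<longleftrightarrow> i \<in> N j" for i j unfolding N_def by (simp add: insert_commute)
  have N_irr: "i \<notin> N i" for i unfolding N_def using simple_graph_edge(1)[OF simple] by blast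
  have N_near: "i + 1 \<in> N i" "i - 1 \<in> N i" for i
    using edge[of i] edge[of "i - 1"] unfolding N_def by (simp_all add: insert_commute)
  have card_N: "card (N i) = 3" for i
  proof -
    have "{e \<in> edges G. D i \<in> e} = (\<lambda>j. {D i, D j}) ` N i"
    proof
      show "{e \<in> edges G. D i \<in> e} \<subseteq> (\<lambda>j. {D i, D j}) ` N i"
      proof
        fix e assume "e \<in> {e \<in> edges G. D i \<in> e}"
        then have e: "e \<in> edges G" "D i \<in> e" by auto
        then have "card e = 2" "e \<subseteq> verts G" using simple unfolding simple_graph_def by auto
        then obtain v where v: "e = {D i, v}" "v \<in> verts G"
          using e(2) by (auto simp: card_2_iff insert_commute)
        then obtain j where "v = D j" using rng by blast
        then show "e \<in> (\<lambda>j. {D i, D j}) ` N i" using v(1) e(1) unfolding N_def by blast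
      qed
    qed (auto simp: N_def)
    moreover have "inj_on (\<lambda>j. {D i, D j}) (N i)"
      using inj by (auto intro!: inj_onI simp: doubleton_eq_iff inj_eq)
    moreover have "vert_degree G (D i) = 3" using deg rng by blast
    ultimately show ?thesis unfolding vert_degree_def by (simp add: card_image)
  qed
  have "\<exists>k. N i = {i - 1, i + 1, k} \<and> k \<noteq> i - 1 \<and> k \<noteq> i + 1" for i
  proof -
    have fin: "finite (N i)" using card_N[of i] by (metis card.infinite zero_neq_numeral)
    have "card (N i - {i - 1, i + 1}) = 1"
      using card_N[of i] N_near[of i] fin by (subst card_Diff_subset) auto
    then obtain k where "N i - {i - 1, i + 1} = {k}" by (rule card_1_singletonE)
    then show ?thesis using N_near[of i] by blast
  qed
  then obtain m where m: "\<And>i. N i = {i - 1, i + 1, m i}" "\<And>i. m i \<noteq> i - 1" "\<And>i. m i \<noteq> i + 1"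
    by metis
  have "chord_matching m"
  proof
    fix i
    show "m i \<noteq> i" using N_irr[of i] m(1)[of i] by auto
    have "i \<in> N (m i)" using m(1)[of i] N_sym by blast
    then show "m (m i) = i" using m(1)[of "m i"] m(2,3)[of i] by auto
  qed (use m in auto)
  then show ?thesis using that m(1) unfolding N_def by blast
qed

text \<open>The piece of the line inside the interval is itself one of the Hamilton paths counted,
  so an even count leaves another one. The permutation \<open>p\<close> is the order in which the
  rerouted line visits the old indices.\<close>

lemma (in chord_matching) reroute_closed_interval:
  assumes cd: "c \<le> d" and closed: "m ` {c..d} \<subseteq> {c..d}"
  obtains p where "bij p" "p \<noteq> id" "\<And>i. i \<notin> {c..d} \<Longrightarrow> p i = i"
    "\<And>i. p (i + 1) \<in> {p i - 1, p i + 1, m (p i)}"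
proof -
  define adj where "adj = (\<lambda>i j. j \<in> {i - 1, i + 1, m i})"
  let ?P = "ham_paths adj {c..d} c d"
  have closed': "m x \<in> {c..d}" if "x \<in> {c..d}" for x using closed that by blast
  have mc: "m c \<in> {c..d}" using closed'[of c] cd by simp
  \<comment> \<open>The partner of \<open>c\<close> lies in the interval and is neither
    \<open>c\<close> nor \<open>c + 1\<close>; so there is an inner vertex, as the parity theorem
    requires.\<close>
  have cd2: "c + 2 \<le> d" using mc no_short[of c] by auto
  have even: "even (card ?P)"
  proof (rule even_card_ham_paths)
    have "c + 1 \<in> {c..d} - {c, d}" using cd2 by auto
    then show "{c..d} \<noteq> {c, d}" by blast
    show "symp adj" unfolding adj_def by (rule sympI) (auto simp: invol)
    show "irreflp adj" unfolding adj_def irreflp_def using no_short(1)[symmetric] by simp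
    fix x assume x: "x \<in> {c..d} - {c, d}"
    then have "m x \<in> {c..d}" using closed' by blast
    then have "{y \<in> {c..d}. adj x y} = {x - 1, x + 1, m x}" using x unfolding adj_def by auto
    moreover have "card {x - 1, x + 1, m x} = 3" using no_short(2,3)[of x, symmetric] by simp
    ultimately show "odd (card {y \<in> {c..d}. adj x y})" by simp
  qed (use cd2 in auto)
  have base: "[c..d] \<in> ?P"
  proof -
    have "successively adj [i..d]" for i
    proof (induction i d rule: upto.induct)
      case (1 i d)
      show ?case
      proof (cases "i \<le> d")
        case True
        have "hd [i + 1..d] = i + 1" if "[i + 1..d] \<noteq> []"
          using that by (simp add: upto_rec1)
        then show ?thesis using True 1 by (subst upto_rec1) (auto simp: successively_Cons adj_def)
      qed simp
    qed
    moreover have "hd [c..d] = c" using cd by (simp add: upto_rec1)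
    moreover have "last [c..d] = d" using cd by (simp add: upto_rec2)
    ultimately show ?thesis using cd unfolding ham_paths_def by simp
  qed
  obtain xs where xs: "xs \<in> ?P" "xs \<noteq> [c..d]"
  proof -
    have "?P \<noteq> {[c..d]}" using even by (metis card_1_singleton_iff One_nat_def odd_one)
    then show ?thesis using base that by blast
  qed
  have xsP: "distinct xs" "set xs = {c..d}" "hd xs = c" "last xs = d" "successively adj xs" "xs \<noteq> []"
    using xs(1) unfolding ham_paths_def by auto
  have len: "length xs = nat (d - c + 1)" using distinct_card[OF xsP(1)] xsP(2) by simp
  \<comment> \<open>The new path also runs from \<open>c\<close> to \<open>d\<close>, so
    \<open>p\<close> fixes both, and the steps into and out of the interval remain line
    edges.\<close>
  define p where "p = (\<lambda>i. if i \<in> {c..d} then xs ! nat (i - c) else i)"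
  have p_out: "p i = i" if "i \<notin> {c..d}" for i using that unfolding p_def by (rule if_not_P)
  have p_in: "p i \<in> {c..d}" if "i \<in> {c..d}" for i
  proof -
    have "nat (i - c) < length xs" using that len by auto
    then show ?thesis using that xsP(2) nth_mem unfolding p_def by auto
  qed
  have pc: "p c = c" using cd xsP(3,6) unfolding p_def by (simp add: hd_conv_nth)
  have pd: "p d = d"
  proof -
    have "nat (d - c) = length xs - 1" using len cd by simp
    then show ?thesis using cd xsP(4,6) unfolding p_def by (simp add: last_conv_nth)
  qed
  have "inj p"
  proof (rule injI)
    fix i j assume eq: "p i = p j"
    then have iff: "i \<in> {c..d} \<longleftrightarrow> j \<in> {c..d}"
      using p_in[of i] p_in[of j] unfolding p_def by (auto split: if_splits)
    show "i = j"
    proof (cases "i \<in> {c..d}")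
      case True
      then have "nat (i - c) < length xs" "nat (j - c) < length xs" using len iff by auto
      then have "nat (i - c) = nat (j - c)"
        using eq True iff xsP(1) unfolding p_def by (simp add: nth_eq_iff_index_eq)
      then show ?thesis using True iff by auto
    next
      case False
      then have "p i = i" "p j = j" using iff p_out by blast+
      then show ?thesis using eq by metis
    qed
  qed
  moreover have "surj p"
  proof -
    have "y \<in> range p" for y
    proof (cases "y \<in> {c..d}")
      case True
      then obtain n where n: "n < length xs" "y = xs ! n" using xsP(2) by (metis in_set_conv_nth)
      then have "p (c + int n) = y" using len unfolding p_def by auto
      then show ?thesis by blast
    next
      case False
      then have "p y = y" by (rule p_out)
      then show ?thesis by (metis rangeI)
    qed
    then show ?thesis by blast
  qed
  ultimately have "bij p" by (rule bijI)
  moreover have "p \<noteq> id"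
  proof
    assume id: "p = id"
    have "xs = [c..d]"
    proof (rule nth_equalityI)
      show "length xs = length [c..d]" using len by simp
      fix n assume n: "n < length xs"
      then have "p (c + int n) = xs ! n" using len unfolding p_def by auto
      moreover have "c + int n \<le> d" using n len by auto
      ultimately show "xs ! n = [c..d] ! n" using id by simp
    qed
    then show False using xs(2) by blast
  qed
  moreover have "p (i + 1) \<in> {p i - 1, p i + 1, m (p i)}" for i
  proof -
    consider "i < c - 1 \<or> i > d" | "i = c - 1" | "i = d" | "c \<le> i" "i < d" by linarith
    then show ?thesis
    proof cases
      case 1 then show ?thesis unfolding p_def by auto
    next
      case 2 then show ?thesis using pc by (simp add: p_def)
    next
      case 3 then show ?thesis using pd by (simp add: p_def)
    next
      case 4
      then have "nat (i + 1 - c) = Suc (nat (i - c))" by simp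
      moreover have "Suc (nat (i - c)) < length xs" using 4 len by simp
      ultimately have "adj (p i) (p (i + 1))"
        using successively_nth[OF xsP(5), of "nat (i - c)"] 4 unfolding p_def by simp
      then show ?thesis unfolding adj_def .
    qed
  qed
  ultimately show ?thesis using that p_out by blast
qed

text \<open>Different indexings can have the same edges, for instance after a shift or a reversal;
  agreement on a half-line rules this out. One of the two edges at \<open>D j\<close> leads back, so
  the next step to the right is forced.\<close>

lemma double_ray_determined_by_edges:
  assumes inj: "inj D" "inj D'" and eq: "range (\<lambda>i::int. {D i, D (i + 1)}) = range (\<lambda>i. {D' i, D' (i + 1)})"
    and agree: "\<And>i. i \<le> c \<Longrightarrow> D' i = D i"
  shows "D' = D"
proof -
  have up: "\<forall>i\<le>j. D' i = D i" if "j \<ge> c" for j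
    using that
  proof (induction j rule: int_ge_induct)
    case (step j)
    have "{D' j, D' (j + 1)} \<in> range (\<lambda>i. {D i, D (i + 1)})" unfolding eq by blast
    then obtain k where k: "{D' j, D' (j + 1)} = {D k, D (k + 1)}" by blast
    have "D' j = D j" "D' (j - 1) = D (j - 1)" using step by auto
    moreover have "D' (j + 1) \<noteq> D' (j - 1)" using inj(2) by (simp add: inj_eq)
    ultimately have "D' (j + 1) = D (j + 1)"
      using k inj(1) by (auto simp: doubleton_eq_iff inj_eq)
    then show ?case using step by (metis zless_add1_eq order_le_less)
  qed (use agree in auto)
  have "D' i = D i" for i using up[of "max c i"] by simp
  then show ?thesis by blast
qed

text \<open>Rays without common vertices have no common edges, and with a single end every ray
  belongs to it.\<close>

lemma end_degree_ge_3:
  assumes simple: "simple_graph G" and one_end: "ends G = {\<omega>}"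
    and r: "\<And>a. ray G (r a)" "\<And>a b k l. a < (3::nat) \<Longrightarrow> b < 3 \<Longrightarrow> r a k = r b l \<Longrightarrow> a = b"
  shows "end_degree \<omega> \<ge> 3"
proof -
  let ?R = "r ` {..<3}"
  have "inj_on r {..<3}" using r(2) by (metis inj_onI lessThan_iff)
  then have card: "card ?R = 3" by (simp add: card_image)
  have "pairwise (\<lambda>r s. disjnt (ray_edges r) (ray_edges s)) ?R"
  proof (rule pairwiseI)
    fix s t assume "s \<in> ?R" "t \<in> ?R" "s \<noteq> t"
    then obtain a b where ab: "s = r a" "t = r b" "a < 3" "b < 3" "a \<noteq> b" by auto
    then have "r a k \<noteq> r b l" for k l using r(2) by blast
    then show "disjnt (ray_edges s) (ray_edges t)"
      unfolding disjnt_def ray_edges_def ab(1,2) by (auto simp: doubleton_eq_iff)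
  qed
  moreover have "?R \<subseteq> \<omega>" using ray_in_unique_end[OF simple one_end r(1)] by blast
  ultimately have "enat (card ?R) \<le> end_degree \<omega>"
    unfolding end_degree_def by (intro Sup_upper) blast
  then show ?thesis unfolding card by (simp add: numeral_eq_enat)
qed

theorem theorem3p1:
  fixes G :: "'a ugraph" and \<omega> :: "(nat \<Rightarrow> 'a) set"
  assumes "cubic_graph G" and "connected_graph G"
    and "ends G = {\<omega>}" and "end_degree \<omega> = 2"
    and "\<exists>H. hamilton_cycle G H"
  shows "\<exists>H1 H2. hamilton_cycle G H1 \<and> hamilton_cycle G H2 \<and> H1 \<noteq> H2"
proof -
  have simple: "simple_graph G" using assms(1) unfolding cubic_graph_def by blast
  obtain D where sdr: "spanning_double_ray G D"
    using assms(5) spanning_double_ray_if_hamilton_circle[OF simple assms(3)]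
    unfolding hamilton_cycle_def by blast
  have inj: "inj D" and rng: "range D = verts G" using sdr unfolding spanning_double_ray_def by auto
  obtain m where "chord_matching m" and adj: "\<And>i j. {D i, D j} \<in> edges G \<longleftrightarrow> j \<in> {i - 1, i + 1, m i}"
    using chord_matching_of_double_ray[OF assms(1) sdr] by metis
  then interpret chord_matching m by simp
  obtain c d where cd: "c \<le> d" "m ` {c..d} \<subseteq> {c..d}"
  proof (rule closed_interval_or_three_orbits)
    fix r :: "nat \<Rightarrow> nat \<Rightarrow> int"
    assume step: "\<And>a n. r a (Suc n) \<in> {r a n - 1, r a n + 1, m (r a n)}"
      and disj: "\<And>a b k l. a < 3 \<Longrightarrow> b < 3 \<Longrightarrow> r a k = r b l \<Longrightarrow> a = b \<and> k = l"
    \<comment> \<open>Orbits are known to be injective for indices below 3 only, while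
      \<open>end_degree_ge_3\<close> asks for a ray at every index; \<open>min a 2\<close> repeats
      the third orbit beyond that.\<close>
    have "ray G (\<lambda>n. D (r (min a 2) n))" for a
      unfolding ray_def
    proof (intro conjI allI injI)
      show "{D (r (min a 2) n), D (r (min a 2) (Suc n))} \<in> edges G" for n using adj step by blast
      fix k l assume "D (r (min a 2) k) = D (r (min a 2) l)"
      then show "k = l" using disj[of "min a 2" "min a 2" k l] inj by (simp add: inj_eq)
    qed
    moreover have "a = b" if "a < 3" "b < 3" "D (r (min a 2) k) = D (r (min b 2) l)" for a b k l
      using that disj[of a b k l] inj by (simp add: inj_eq min_def split: if_splits)
    ultimately have "end_degree \<omega> \<ge> 3"
      by (intro end_degree_ge_3[OF simple assms(3), of "\<lambda>a n. D (r (min a 2) n)"]) auto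
    then show thesis using assms(4) by simp
  qed blast
  obtain p where p: "bij p" "p \<noteq> id" "\<And>i. i \<notin> {c..d} \<Longrightarrow> p i = i"
      "\<And>i. p (i + 1) \<in> {p i - 1, p i + 1, m (p i)}"
    using reroute_closed_interval[OF cd] by metis
  define D' where "D' = D \<circ> p"
  have sdr': "spanning_double_ray G D'"
    unfolding spanning_double_ray_def D'_def
    using inj_compose[OF inj bij_is_inj[OF p(1)]] bij_is_surj[OF p(1)] rng adj p(4)
    by (metis comp_apply image_comp)
  have "range (\<lambda>i. {D i, D (i + 1)}) \<noteq> range (\<lambda>i. {D' i, D' (i + 1)})"
  proof
    assume eq: "range (\<lambda>i. {D i, D (i + 1)}) = range (\<lambda>i. {D' i, D' (i + 1)})"
    have "inj D'" using sdr' unfolding spanning_double_ray_def by blast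
    then have "D' = D"
      by (rule double_ray_determined_by_edges[OF inj _ eq, of "c - 1"]) (simp add: D'_def p(3))
    then have "D (p i) = D i" for i unfolding D'_def by (metis comp_apply)
    then show False using p(2) inj by (auto simp: inj_eq)
  qed
  then have "\<lparr>verts = verts G, edges = range (\<lambda>i. {D i, D (i + 1)})\<rparr> \<noteq>
      \<lparr>verts = verts G, edges = range (\<lambda>i. {D' i, D' (i + 1)})\<rparr>" by simp
  moreover have "hamilton_cycle G \<lparr>verts = verts G, edges = range (\<lambda>i. {E i, E (i + 1)})\<rparr>"
    if "spanning_double_ray G E" for E
    using double_ray_in_one_ended.hamilton_cycle_double_ray simple assms(3) that
    unfolding double_ray_in_one_ended_def by blast
  ultimately show ?thesis using sdr sdr' by blast
qed

end
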